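(* Let $\mathbf{k}$ be an algebraically closed field of characteristic zero, $A=\mathbf{k}[x,y,z]/\langle x^2+y^2+z^2-1\rangle$, $\mathcal{V}=\mathrm{Der}_{\mathbf{k}}(A)$, $m\in\mathbb{Z}_{\geq0}$ and $\alpha\in\mathbf{k}$. If $\frac{m-\alpha}{2}\in\mathbb{Z}$, then the vector $$w_m:=\sum_{i=0}^{m}z^{-\frac{\alpha+m}{2}}x^{m-i}y^{i}\otimes v_i$$ generates a bounded $A\mathcal{V}$-submodule of $A_{(z)}\otimes U_m^{\alpha}$. On the other hand, if $\frac{m-\alpha}{2}\notin\mathbb{Z}$, then $A_{(z)}\otimes U_m^{\alpha}$ contains no nonzero bounded $A\mathcal{V}$-submodules.
   Context: An $A\mathcal{V}$-module is a $\mathbf{k}$-vector space $M$ that is both a module over the commutative unital algebra $A$ and a module over the Lie algebra $\mathcal{V}$, such that $\eta\cdot(a\cdot m)=\eta(a)\cdot m+a\cdot(\eta\cdot m)$ for all $a\in A$, $\eta\in\mathcal{V}$, $m\in M$. Submodules are closed under both actions. $A_{(z)}=A[z^{-1}]$. The derivations $\frac{\partial}{\partial x},\frac{\partial}{\partial y}$ of $\mathbf{k}[x,y]$ extend uniquely to $A_{(z)}$, with $\frac{\partial z}{\partial x}=-\frac{x}{z}$, $\frac{\partial z}{\partial y}=-\frac{y}{z}$, and $\mathcal{V}\subset\mathrm{Der}(A_{(z)})=A_{(z)}\frac{\partial}{\partial x}\oplus A_{(z)}\frac{\partial}{\partial y}$. Put $t_1=x$, $t_2=y$. For a finite-dimensional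 $\mathfrak{gl}_2$-module $U$, the space $A_{(z)}\otimes_{\mathbf{k}}U$ is an $A\mathcal{V}$-module: $A$ acts by multiplication on the left factor, and $$\Big(\sum_{i=1}^{2}f_i\frac{\partial}{\partial t_i}\Big)\cdot(g\otimes u)=\sum_{i=1}^{2}f_i\frac{\partial g}{\partial t_i}\otimes u+\sum_{p=1}^{2}\sum_{i=1}^{2}g\frac{\partial f_i}{\partial t_p}\otimes(E_{p,i}\cdot u),$$ where $E_{p,i}$ are the matrix units of $\mathfrak{gl}_2$. $U_m^{\alpha}$ is the simple $\mathfrak{gl}_2$-module with basis $v_0,\dots,v_m$ and action (with $v_{-1}=v_{m+1}=0$) $$E_{1,1}v_i=\tfrac12(\alpha+m-2i)v_i,\quad E_{1,2}v_i=(m-i+1)v_{i-1},\quad E_{2,1}v_i=(i+1)v_{i+1},\quad E_{2,2}v_i=\tfrac12(\alpha-m+2i)v_i.$$ For nonzero $w\in A_{(z)}\otimes U$, $\deg w:=\max\{k\in\mathbb{Z}: w\in z^kA\otimes U\}$. A nonzero submodule $M\subset A_{(z)}\otimes U$ is called bounded if $\inf\{\deg w: w\in M,\ w\neq0\}$ is finite, i.e. $M\subset z^kA\otimes U$ for some $k\in\mathbb{Z}$. *)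

theory Defs
  imports "HOL-Computational_Algebra.Polynomial" "HOL-Library.Function_Algebras"
begin

section \<open>The coordinate ring of the sphere\<close>

text \<open>Trivariate polynomials are iterated univariate ones: the outermost variable is z,
  the next one is y and the innermost one is x.\<close>

definition poly_x :: "'k::field poly poly poly" where "poly_x = [:[:[:0, 1:]:]:]"
definition poly_y :: "'k::field poly poly poly" where "poly_y = [:[:0, 1:]:]"
definition poly_z :: "'k::field poly poly poly" where "poly_z = [:0, 1:]"

definition sphere_poly :: "'k::field poly poly poly" where
  "sphere_poly = poly_x ^ 2 + poly_y ^ 2 + poly_z ^ 2 - 1"

text \<open>Otherwise the lifting package would unfold polynomials to coefficient functions.\<close>

lifting_forget poly.lifting

quotient_type (overloaded) 'k sphere =
  "'k::field poly poly poly" / "\<lambda>p q. sphere_poly dvd p - q"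
proof (rule equivpI)
  show "reflp (\<lambda>p q. sphere_poly dvd p - q)" by (simp add: reflp_def)
  show "symp (\<lambda>p q. sphere_poly dvd p - q)" 
    by (rule sympI) (metis dvd_minus_iff minus_diff_eq)
  show "transp (\<lambda>p q. sphere_poly dvd p - q)"
    by (rule transpI) (use dvd_add in fastforce)
qed

instantiation sphere :: (field) comm_ring_1
begin

lift_definition zero_sphere :: "'a sphere" is 0 .
lift_definition one_sphere :: "'a sphere" is 1 .
lift_definition plus_sphere :: "'a sphere \<Rightarrow> 'a sphere \<Rightarrow> 'a sphere" is "(+)"
  by (simp only: add_diff_add dvd_add)
lift_definition uminus_sphere :: "'a sphere \<Rightarrow> 'a sphere" is uminus
  by (simp only: minus_diff_minus dvd_minus_iff)
lift_definition minus_sphere :: "'a sphere \<Rightarrow> 'a sphere \<Rightarrow> 'a sphere" is "(-)"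
proof -
  fix a b c d :: "'a poly poly poly"
  assume "sphere_poly dvd a - b" "sphere_poly dvd c - d"
  then have "sphere_poly dvd (a - b) - (c - d)" by (rule dvd_diff)
  then show "sphere_poly dvd a - c - (b - d)" by (simp add: algebra_simps)
qed
lift_definition times_sphere :: "'a sphere \<Rightarrow> 'a sphere \<Rightarrow> 'a sphere" is "(*)"
proof -
  fix a b c d :: "'a poly poly poly"
  assume *: "sphere_poly dvd a - b" "sphere_poly dvd c - d"
  have "a * c - b * d = (a - b) * c + b * (c - d)" by (simp add: algebra_simps)
  with * show "sphere_poly dvd a * c - b * d" by simp
qed

instance
proof
  show "(0::'a sphere) \<noteq> 1"
  proof (transfer, rule notI)
    assume "sphere_poly dvd (0 - 1 :: 'a poly poly poly)"
    then obtain r where r: "0 - 1 = (sphere_poly * r :: 'a poly poly poly)" by (elim dvdE)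
    from arg_cong[OF r, of "\<lambda>p. poly (poly (poly p 1) 0) 0"] show False
      by (simp add: sphere_poly_def poly_x_def poly_y_def poly_z_def)
  qed
qed (transfer, simp add: algebra_simps)+

end

lift_definition sphere_of :: "'k::field poly poly poly \<Rightarrow> 'k sphere" is "\<lambda>p. p" .

definition sphere_const :: "'k::field \<Rightarrow> 'k sphere" where
  "sphere_const c = sphere_of [:[:[:c:]:]:]"

definition sphere_x :: "'k::field sphere" where "sphere_x = sphere_of poly_x"
definition sphere_y :: "'k::field sphere" where "sphere_y = sphere_of poly_y"
definition sphere_z :: "'k::field sphere" where "sphere_z = sphere_of poly_z"


lemma sphere_equation: "sphere_x ^ 2 + sphere_y ^ 2 + sphere_z ^ 2 = (1 :: 'k::field sphere)"
  unfolding sphere_x_def sphere_y_def sphere_z_def power2_eq_square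
  by transfer (simp add: sphere_poly_def power2_eq_square)

lemma sphere_of_hom [simp]:
  "sphere_of 0 = 0" "sphere_of 1 = 1"
  "sphere_of (p + q) = sphere_of p + sphere_of q"
  "sphere_of (p * q) = sphere_of p * sphere_of q"
  by (transfer, simp)+

lemma sphere_of_eq_iff: "sphere_of p = sphere_of q \<longleftrightarrow> sphere_poly dvd p - q"
  by transfer simp

lemma sphere_cases: obtains p where "a = sphere_of p"
  by transfer (metis diff_self dvd_0_right)

lemma sphere_const_hom [simp]:
  "sphere_const 0 = 0" "sphere_const 1 = 1"
  "sphere_const (c + d) = sphere_const c + sphere_const d"
  "sphere_const (c * d) = sphere_const c * sphere_const d"
proof -
  show "sphere_const 0 = 0" by (simp add: sphere_const_def)
  show "sphere_const 1 = 1" by (simp add: sphere_const_def flip: one_pCons)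
  have "[:[:[:c + d:]:]:] = [:[:[:c:]:]:] + [:[:[:d:]:]:]" by simp
  then show "sphere_const (c + d) = sphere_const c + sphere_const d"
    unfolding sphere_const_def by (simp only: sphere_of_hom)
  have "[:[:[:c * d:]:]:] = [:[:[:c:]:]:] * [:[:[:d:]:]:]" by simp
  then show "sphere_const (c * d) = sphere_const c * sphere_const d"
    unfolding sphere_const_def by (simp only: sphere_of_hom)
qed

section \<open>Localization at z\<close>

text \<open>The pair \<open>(a, n)\<close> stands for the fraction \<open>a / z ^ n\<close>.\<close>

definition loc_rel :: "'k::field sphere \<times> nat \<Rightarrow> 'k sphere \<times> nat \<Rightarrow> bool" where
  "loc_rel r s \<longleftrightarrow>
    (\<exists>k. sphere_z ^ k * (sphere_z ^ snd s * fst r - sphere_z ^ snd r * fst s) = 0)"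

lemma loc_rel_iff:
  "loc_rel (a, m) (b, n) \<longleftrightarrow> (\<exists>k. sphere_z ^ (k + n) * a = sphere_z ^ (k + m) * b)"
  by (simp add: loc_rel_def power_add algebra_simps)

lifting_forget sphere.lifting

quotient_type (overloaded) 'k sphere_loc = "'k::field sphere \<times> nat" / loc_rel
proof (rule equivpI)
  show "reflp (loc_rel :: 'k sphere \<times> nat \<Rightarrow> _)" by (simp add: reflp_def loc_rel_def)
  show "symp (loc_rel :: 'k sphere \<times> nat \<Rightarrow> _)"
    by (auto simp: symp_def loc_rel_iff) metis
  show "transp (loc_rel :: 'k sphere \<times> nat \<Rightarrow> _)"
  proof (rule transpI, clarify)
    fix a b c :: "'k sphere" and l m n :: nat
    assume "loc_rel (a, l) (b, m)" "loc_rel (b, m) (c, n)"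
    then obtain i j where i: "sphere_z ^ (i + m) * a = sphere_z ^ (i + l) * b"
      and j: "sphere_z ^ (j + n) * b = sphere_z ^ (j + m) * c"
      by (auto simp: loc_rel_iff)
    have "sphere_z ^ ((i + j + m) + n) * a = sphere_z ^ (j + n) * (sphere_z ^ (i + m) * a)"
      by (simp add: power_add algebra_simps)
    also have "\<dots> = sphere_z ^ (i + l) * (sphere_z ^ (j + n) * b)"
      by (simp only: i mult.left_commute)
    also have "\<dots> = sphere_z ^ (i + l) * (sphere_z ^ (j + m) * c)"
      by (simp only: j)
    also have "\<dots> = sphere_z ^ ((i + j + m) + l) * c"
      by (simp add: power_add algebra_simps)
    finally show "loc_rel (a, l) (c, n)" unfolding loc_rel_iff by blast
  qed
qed

lift_definition z_frac :: "'k::field sphere \<Rightarrow> nat \<Rightarrow> 'k sphere_loc" is Pair .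

lemma z_frac_eq_iff:
  "z_frac a m = z_frac b n \<longleftrightarrow> (\<exists>k. sphere_z ^ (k + n) * a = sphere_z ^ (k + m) * b)"
  by transfer (simp add: loc_rel_iff)

lemma z_frac_cases [cases type: sphere_loc]: obtains a n where "g = z_frac a n"
  by transfer (metis surj_pair loc_rel_iff)

instantiation sphere_loc :: (field) comm_ring_1
begin

lift_definition zero_sphere_loc :: "'a sphere_loc" is "(0, 0)" .
lift_definition one_sphere_loc :: "'a sphere_loc" is "(1, 0)" .
lift_definition plus_sphere_loc :: "'a sphere_loc \<Rightarrow> 'a sphere_loc \<Rightarrow> 'a sphere_loc"
  is "\<lambda>(a, m) (b, n). (sphere_z ^ n * a + sphere_z ^ m * b, m + n)"
proof (clarsimp simp: loc_rel_iff)
  fix a a' b b' :: "'a sphere" and m m' n n' i j :: nat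
  assume i: "sphere_z ^ (i + m') * a = sphere_z ^ (i + m) * a'"
    and j: "sphere_z ^ (j + n') * b = sphere_z ^ (j + n) * b'"
  have "sphere_z ^ ((i + j) + (m' + n')) * (sphere_z ^ n * a + sphere_z ^ m * b) =
      sphere_z ^ (j + n + n') * (sphere_z ^ (i + m') * a) +
      sphere_z ^ (i + m + m') * (sphere_z ^ (j + n') * b)"
    by (simp add: power_add algebra_simps)
  also have "\<dots> = sphere_z ^ ((i + j) + (m + n)) * (sphere_z ^ n' * a' + sphere_z ^ m' * b')"
    unfolding i j by (simp add: power_add algebra_simps)
  finally show "\<exists>k. sphere_z ^ (k + (m' + n')) * (sphere_z ^ n * a + sphere_z ^ m * b) =
      sphere_z ^ (k + (m + n)) * (sphere_z ^ n' * a' + sphere_z ^ m' * b')" by blast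
qed
lift_definition uminus_sphere_loc :: "'a sphere_loc \<Rightarrow> 'a sphere_loc"
  is "\<lambda>(a, m). (- a, m)"
  by (clarsimp simp: loc_rel_iff)
definition minus_sphere_loc :: "'a sphere_loc \<Rightarrow> 'a sphere_loc \<Rightarrow> 'a sphere_loc"
  where "minus_sphere_loc g h = g + - h"
lift_definition times_sphere_loc :: "'a sphere_loc \<Rightarrow> 'a sphere_loc \<Rightarrow> 'a sphere_loc"
  is "\<lambda>(a, m) (b, n). (a * b, m + n)"
proof (clarsimp simp: loc_rel_iff)
  fix a a' b b' :: "'a sphere" and m m' n n' i j :: nat
  assume i: "sphere_z ^ (i + m') * a = sphere_z ^ (i + m) * a'"
    and j: "sphere_z ^ (j + n') * b = sphere_z ^ (j + n) * b'"
  have "sphere_z ^ ((i + j) + (m' + n')) * (a * b) =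
      (sphere_z ^ (i + m') * a) * (sphere_z ^ (j + n') * b)"
    by (simp add: power_add algebra_simps)
  also have "\<dots> = sphere_z ^ ((i + j) + (m + n)) * (a' * b')"
    unfolding i j by (simp add: power_add algebra_simps)
  finally show "\<exists>k. sphere_z ^ (k + (m' + n')) * (a * b) =
      sphere_z ^ (k + (m + n)) * (a' * b')" by blast
qed

lemma z_frac_simps:
  "0 = z_frac 0 0" "1 = z_frac 1 0"
  "z_frac a m + z_frac b n = z_frac (sphere_z ^ n * a + sphere_z ^ m * b) (m + n)"
  "- z_frac a m = z_frac (- a) m"
  "z_frac a m * z_frac b n = z_frac (a * b) (m + n)"
  by (transfer, simp add: loc_rel_def)+

lemma sphere_z_power_not_0: "sphere_z ^ n \<noteq> (0 :: 'k::field sphere)"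
proof -
  define red :: "'k poly poly poly \<Rightarrow> 'k" where "red p = poly (poly (poly p 1) 0) 0" for p
  have "\<not> sphere_poly dvd (poly_z ^ n :: 'k poly poly poly)"
  proof
    assume "sphere_poly dvd (poly_z ^ n :: 'k poly poly poly)"
    then obtain r where "(poly_z ^ n :: 'k poly poly poly) = sphere_poly * r" by (elim dvdE)
    then have "red (poly_z ^ n) = red sphere_poly * red r" by (simp add: red_def)
    then show False
      by (simp add: red_def sphere_poly_def poly_x_def poly_y_def poly_z_def)
  qed
  moreover have "sphere_z ^ n = (sphere_of (poly_z ^ n) :: 'k sphere)"
    by (induction n) (simp_all add: sphere_z_def)
  ultimately show ?thesis
    by (metis sphere_of_eq_iff sphere_of_hom(1) diff_zero)
qed

instance
proof
  fix f g h :: "'a sphere_loc"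
  show "f + g + h = f + (g + h)"
    by (cases f, cases g, cases h) (simp add: z_frac_simps power_add algebra_simps)
  show "f + g = g + f"
    by (cases f, cases g) (simp add: z_frac_simps algebra_simps)
  show "0 + f = f" by (cases f) (simp add: z_frac_simps)
  show "- f + f = 0" by (cases f) (simp add: z_frac_simps z_frac_eq_iff)
  show "f - g = f + - g" by (simp add: minus_sphere_loc_def)
  show "f * g * h = f * (g * h)"
    by (cases f, cases g, cases h) (simp add: z_frac_simps algebra_simps)
  show "f * g = g * f"
    by (cases f, cases g) (simp add: z_frac_simps algebra_simps)
  show "1 * f = f" by (cases f) (simp add: z_frac_simps)
  show "(f + g) * h = f * h + g * h"
  proof (cases f, cases g, cases h)
    fix a b c l m n assume "f = z_frac a l" "g = z_frac b m" "h = z_frac c n"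
    then show ?thesis
      by (simp add: z_frac_simps z_frac_eq_iff power_add algebra_simps)
  qed
  show "(0 :: 'a sphere_loc) \<noteq> 1"
    using sphere_z_power_not_0 by (metis z_frac_simps(1,2) z_frac_eq_iff mult_zero_right mult.right_neutral)
qed

end

definition to_loc :: "'k::field sphere \<Rightarrow> 'k sphere_loc" where "to_loc a = z_frac a 0"

definition loc_const :: "'k::field \<Rightarrow> 'k sphere_loc" where
  "loc_const c = to_loc (sphere_const c)"

definition z_inv :: "'k::field sphere_loc" where "z_inv = z_frac 1 1"

definition z_pow :: "int \<Rightarrow> 'k::field sphere_loc" where
  "z_pow e = (if 0 \<le> e then to_loc sphere_z ^ nat e else z_inv ^ nat (- e))"

lemma to_loc_hom [simp]:
  "to_loc 0 = 0" "to_loc 1 = 1" "to_loc (- a) = - to_loc a"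
  "to_loc (a + b) = to_loc a + to_loc b" "to_loc (a * b) = to_loc a * to_loc b"
  by (simp_all add: to_loc_def z_frac_simps)

lemma to_loc_diff [simp]: "to_loc (a - b) = to_loc a - to_loc b"
  by (simp add: to_loc_hom(4)[of a "- b", simplified])

lemma to_loc_power [simp]: "to_loc (a ^ n) = to_loc a ^ n"
  by (induction n) simp_all

lemma z_inv [simp]: "to_loc sphere_z * z_inv = 1" "z_inv * to_loc sphere_z = 1"
  by (simp_all add: z_inv_def to_loc_def z_frac_simps z_frac_eq_iff)

lemma z_frac_conv: "z_frac a n = to_loc a * z_inv ^ n"
proof (induction n)
  case (Suc n)
  have "z_frac a (Suc n) = z_frac a n * z_inv" by (simp add: z_inv_def z_frac_simps)
  with Suc show ?case by (simp add: algebra_simps)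
qed (simp add: to_loc_def)


lemma loc_const_hom [simp]:
  "loc_const 0 = 0" "loc_const 1 = 1"
  "loc_const (c + d) = loc_const c + loc_const d"
  "loc_const (c * d) = loc_const c * loc_const d"
  by (simp_all add: loc_const_def)

lemma loc_const_minus [simp]:
  "loc_const (- c) = - loc_const c" "loc_const (c - d) = loc_const c - loc_const d"
proof -
  have *: "loc_const (- c) = - loc_const c" for c :: 'a
    using loc_const_hom(3)[of c "- c"] by (simp add: eq_neg_iff_add_eq_0 add.commute)
  show "loc_const (- c) = - loc_const c" by (rule *)
  show "loc_const (c - d) = loc_const c - loc_const d"
    using loc_const_hom(3)[of c "- d"] by (simp add: *)
qed

section \<open>Derivations\<close>

text \<open>The map \<open>\<iota>\<close> is the structure map of the k-algebra \<open>'r\<close>.\<close>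

definition derivation :: "('k \<Rightarrow> 'r::comm_ring_1) \<Rightarrow> ('r \<Rightarrow> 'r) \<Rightarrow> bool" where
  "derivation \<iota> D \<longleftrightarrow>
    (\<forall>a b. D (a + b) = D a + D b) \<and>
    (\<forall>c a. D (\<iota> c * a) = \<iota> c * D a) \<and>
    (\<forall>a b. D (a * b) = D a * b + a * D b)"

definition Der :: "('k::field sphere \<Rightarrow> 'k sphere) set" where
  "Der = {\<eta>. derivation sphere_const \<eta>}"

text \<open>\<open>Der\<close> is the Lie algebra of derivations of the coordinate ring; its bracket is the
  commutator, see the lemmas \<open>Der_bracket\<close> and \<open>V_act_bracket\<close>.\<close>

text \<open>The coordinates \<open>t\<^sub>1 = x\<close> and \<open>t\<^sub>2 = y\<close>, the inclusion of \<open>k[x,y]\<close>, and the two partial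
  derivatives of \<open>k[x,y]\<close> together with their extensions to the localization.\<close>

definition t_var :: "nat \<Rightarrow> 'k::field sphere" where
  "t_var i = (if i = 1 then sphere_x else sphere_y)"

definition of_poly_xy :: "'k::field poly poly \<Rightarrow> 'k sphere_loc" where
  "of_poly_xy p = to_loc (sphere_of [:p:])"

definition pderiv_xy :: "nat \<Rightarrow> 'k::field poly poly \<Rightarrow> 'k poly poly" where
  "pderiv_xy i = (if i = 1 then map_poly pderiv else pderiv)"

definition partial :: "nat \<Rightarrow> 'k::field sphere_loc \<Rightarrow> 'k sphere_loc" where
  "partial i = (THE D. derivation loc_const D \<and>
    (\<forall>p. D (of_poly_xy p) = of_poly_xy (pderiv_xy i p)))"

lemma derivation_add: "derivation \<iota> D \<Longrightarrow> D (a + b) = D a + D b"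
  and derivation_scale: "derivation \<iota> D \<Longrightarrow> D (\<iota> c * a) = \<iota> c * D a"
  and derivation_mult: "derivation \<iota> D \<Longrightarrow> D (a * b) = D a * b + a * D b"
  by (unfold derivation_def, blast+)

lemma derivation_0: "derivation \<iota> D \<Longrightarrow> D 0 = 0"
  using derivation_add[of \<iota> D 0 0] by simp

lemma derivation_1: "derivation \<iota> D \<Longrightarrow> D 1 = 0"
  using derivation_mult[of \<iota> D 1 1] by simp

lemma derivation_const: "derivation \<iota> D \<Longrightarrow> D (\<iota> c) = 0"
  using derivation_scale[of \<iota> D c 1] by (simp add: derivation_1)

lemma derivation_lincomb:
  assumes "derivation \<iota> D" "derivation \<iota> D'"
  shows "derivation \<iota> (\<lambda>a. f * D a + g * D' a)"
  using assms by (auto simp: derivation_def algebra_simps)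

lemma derivation_eq_0_on_sphere:
  fixes D :: "'k::field_char_0 sphere_loc \<Rightarrow> 'k sphere_loc"
  assumes D: "derivation loc_const D" and x: "D (to_loc sphere_x) = 0"
    and y: "D (to_loc sphere_y) = 0"
  shows "D g = 0"
proof -
  let ?Z = "to_loc sphere_z :: 'k sphere_loc"
  have "?Z * ?Z = 1 - to_loc sphere_x * to_loc sphere_x - to_loc sphere_y * to_loc sphere_y"
    using arg_cong[OF sphere_equation[where 'k = 'k], of to_loc]
    by (simp add: power2_eq_square algebra_simps)
  moreover have diff: "D (a - b) = D a - D b" for a b
    using derivation_add[OF D, of "a - b" b] by (simp add: algebra_simps)
  ultimately have "D (?Z * ?Z) = 0"
    by (simp add: diff derivation_1[OF D] derivation_mult[OF D] x y)
  then have "D ?Z * ?Z + D ?Z * ?Z = 0" by (simp add: derivation_mult[OF D] mult.commute)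
  then have "loc_const (1/2) * z_inv * (D ?Z * ?Z + D ?Z * ?Z) = 0" by simp
  moreover have "loc_const (1/2) * z_inv * (D ?Z * ?Z + D ?Z * ?Z) =
      (loc_const (1/2) + loc_const (1/2)) * (?Z * z_inv) * D ?Z"
    by (simp only: algebra_simps)
  moreover have "loc_const (1/2) + loc_const (1/2) = (1 :: 'k sphere_loc)"
    by (simp flip: loc_const_hom(3))
  ultimately have z: "D ?Z = 0" by simp
  have 1: "D (to_loc (sphere_of [:[:p:]:])) = 0" for p
  proof (induction p)
    case (pCons c p)
    have "[:[:pCons c p:]:] = [:[:[:c:]:]:] + poly_x * [:[:p:]:]"
      by (simp add: poly_x_def)
    then have "to_loc (sphere_of [:[:pCons c p:]:]) =
        loc_const c + to_loc sphere_x * to_loc (sphere_of [:[:p:]:])"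
      by (simp only: sphere_of_hom to_loc_hom loc_const_def sphere_const_def sphere_x_def)
    then show ?case
      by (simp add: derivation_add[OF D] derivation_const[OF D] derivation_mult[OF D] x pCons)
  qed (simp add: derivation_0[OF D])
  have 2: "D (to_loc (sphere_of [:p:])) = 0" for p
  proof (induction p)
    case (pCons c p)
    have "[:pCons c p:] = [:[:c:]:] + poly_y * [:p:]"
      by (simp add: poly_y_def)
    then have "to_loc (sphere_of [:pCons c p:]) =
        to_loc (sphere_of [:[:c:]:]) + to_loc sphere_y * to_loc (sphere_of [:p:])"
      by (simp only: sphere_of_hom to_loc_hom sphere_y_def)
    then show ?case
      by (simp add: derivation_add[OF D] 1 derivation_mult[OF D] y pCons)
  qed (simp add: derivation_0[OF D])
  have 3: "D (to_loc (sphere_of p)) = 0" for p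
  proof (induction p)
    case (pCons c p)
    have "pCons c p = [:c:] + poly_z * p"
      by (simp add: poly_z_def)
    then have "to_loc (sphere_of (pCons c p)) =
        to_loc (sphere_of [:c:]) + ?Z * to_loc (sphere_of p)"
      by (simp only: sphere_of_hom to_loc_hom sphere_z_def)
    then show ?case
      by (simp add: derivation_add[OF D] 2 derivation_mult[OF D] z pCons)
  qed (simp add: derivation_0[OF D])
  have "?Z * D z_inv = D (?Z * z_inv)" by (simp only: derivation_mult[OF D] z) simp
  then have "z_inv * (?Z * D z_inv) = 0" by (simp add: derivation_1[OF D])
  then have zi: "D z_inv = 0" by (simp flip: mult.assoc)
  have "D (z_inv ^ n) = 0" for n
    by (induction n) (simp_all add: derivation_1[OF D] derivation_mult[OF D] zi)
  with 3 show ?thesis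
    by (cases g) (metis z_frac_conv sphere_cases derivation_mult[OF D] mult_zero_left mult_zero_right add_0)
qed

lemma derivation_eqI:
  fixes D D' :: "'k::field_char_0 sphere_loc \<Rightarrow> 'k sphere_loc"
  assumes "derivation loc_const D" "derivation loc_const D'"
    and "D (to_loc sphere_x) = D' (to_loc sphere_x)"
    and "D (to_loc sphere_y) = D' (to_loc sphere_y)"
  shows "D = D'"
proof
  fix g
  have "derivation loc_const (\<lambda>g. 1 * D g + (- 1) * D' g)"
    by (rule derivation_lincomb) (rule assms)+
  from derivation_eq_0_on_sphere[OF this, of g] show "D g = D' g" using assms by simp
qed

lemma derivation_extends_to_loc:
  fixes \<delta> :: "'k::field sphere \<Rightarrow> 'k sphere_loc"
  assumes add: "\<And>a b. \<delta> (a + b) = \<delta> a + \<delta> b"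
    and scale: "\<And>c a. \<delta> (sphere_const c * a) = loc_const c * \<delta> a"
    and mult: "\<And>a b. \<delta> (a * b) = \<delta> a * to_loc b + to_loc a * \<delta> b"
  obtains D where "derivation loc_const D" "\<And>a. D (to_loc a) = \<delta> a"
proof -
  let ?Z = "to_loc sphere_z :: 'k sphere_loc" and ?d = "\<delta> sphere_z"
  define F where "F a n = \<delta> a * z_inv ^ n - of_nat n * (to_loc a * z_inv ^ n * z_inv * ?d)" for a n
  have one: "\<delta> 1 = 0" using mult[of 1 1] by simp
  have Zn: "?Z ^ n * z_inv ^ n = 1" for n by (simp flip: power_mult_distrib)
  have pow: "\<delta> (sphere_z ^ n) = of_nat n * (?Z ^ n * z_inv * ?d)" for n
  proof (induction n)
    case (Suc n)
    have "\<delta> (sphere_z ^ Suc n) = (?Z * z_inv) * ?d * ?Z ^ n + ?Z * \<delta> (sphere_z ^ n)"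
      by (simp add: mult)
    then show ?case unfolding Suc by (simp only: algebra_simps of_nat_Suc power_Suc mult_1_left)
  qed (simp add: one)
  have cancel: "F (sphere_z ^ N * a) (N + n) = F a n" for N a n
  proof -
    have "F (sphere_z ^ N * a) (N + n) = (?Z ^ N * z_inv ^ N) * F a n"
      unfolding F_def mult pow
      by (simp add: power_add algebra_simps)
    then show ?thesis by (simp add: Zn)
  qed
  have wd: "F a m = F b n" if "z_frac a m = z_frac b n" for a b m n
  proof -
    from that obtain k where k: "sphere_z ^ (k + n) * a = sphere_z ^ (k + m) * b"
      by (auto simp: z_frac_eq_iff)
    have "F a m = F (sphere_z ^ (k + n) * a) (k + n + m)" by (rule cancel[symmetric])
    also have "\<dots> = F (sphere_z ^ (k + m) * b) (k + m + n)" by (simp only: k add_ac)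
    also have "\<dots> = F b n" by (rule cancel)
    finally show ?thesis .
  qed
  define D where "D g = (THE h. \<exists>a n. g = z_frac a n \<and> h = F a n)" for g
  have D: "D (z_frac a n) = F a n" for a n
    unfolding D_def by (rule the_equality, blast, clarify, erule wd[symmetric])
  have "derivation loc_const D"
    unfolding derivation_def
  proof (intro conjI allI)
    fix f g c
    show "D (f + g) = D f + D g"
    proof (cases f, cases g)
      fix a b m n assume fg: "f = z_frac a m" "g = z_frac b n"
      have "F (a + b) n = F a n + F b n" for a b n
        by (simp add: F_def add algebra_simps)
      then have "D (f + g) = F (sphere_z ^ n * a) (n + m) + F (sphere_z ^ m * b) (m + n)"
        by (simp add: fg z_frac_simps D add_ac)
      then show ?thesis by (simp only: cancel fg D)
    qed
    show mul: "D (f * g) = D f * g + f * D g" for f g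
    proof (cases f, cases g)
      fix a b m n assume fg: "f = z_frac a m" "g = z_frac b n"
      have "D (f * g) = F (a * b) (m + n)" by (simp add: fg z_frac_simps D)
      also have "\<dots> = F a m * g + f * F b n"
        by (simp add: fg z_frac_conv F_def mult power_add algebra_simps)
      finally show ?thesis by (simp add: fg D)
    qed
    have "D (loc_const c) = 0"
      using scale[of c 1] by (simp add: loc_const_def D to_loc_def F_def one)
    then show "D (loc_const c * g) = loc_const c * D g" by (simp add: mul)
  qed
  moreover have "D (to_loc a) = \<delta> a" for a by (simp add: to_loc_def D F_def)
  ultimately show ?thesis by (rule that)
qed

lemma map_poly_derivation:
  fixes d :: "'r::comm_ring_1 \<Rightarrow> 'r"
  assumes 0: "d 0 = 0" and add: "\<And>a b. d (a + b) = d a + d b"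
    and mult: "\<And>a b. d (a * b) = d a * b + a * d b"
  shows "map_poly d (p + q) = map_poly d p + map_poly d q"
    and "map_poly d (p * q) = map_poly d p * q + p * map_poly d q"
proof -
  show "map_poly d (p + q) = map_poly d p + map_poly d q"
    by (rule poly_eqI) (simp add: coeff_map_poly 0 add)
  have sum: "d (sum f S) = (\<Sum>i\<in>S. d (f i))" if "finite S" for f and S :: "nat set"
    using that by (induction S) (simp_all add: 0 add)
  show "map_poly d (p * q) = map_poly d p * q + p * map_poly d q"
    by (rule poly_eqI) (simp add: coeff_map_poly 0 coeff_mult sum mult sum.distrib)
qed

lemma pderiv_xy_derivation:
  "pderiv_xy i 0 = 0" "pderiv_xy i (p + q) = pderiv_xy i p + pderiv_xy i q"
  "pderiv_xy i (p * q) = pderiv_xy i p * q + p * pderiv_xy i q"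
  by (auto simp: pderiv_xy_def pderiv_add pderiv_mult algebra_simps
      intro!: map_poly_derivation(1) trans[OF map_poly_derivation(2)])

lemma partial_exists:
  obtains D :: "'k::field sphere_loc \<Rightarrow> 'k sphere_loc" where "derivation loc_const D"
    "\<And>p. D (of_poly_xy p) = of_poly_xy (pderiv_xy i p)"
    "D (to_loc sphere_z) = - to_loc (t_var i) * z_inv"
proof -
  define G :: "'k poly poly poly \<Rightarrow> 'k sphere_loc" where
    "G p = to_loc (sphere_of (map_poly (pderiv_xy i) p)) -
      to_loc (t_var i) * z_inv * to_loc (sphere_of (pderiv p))" for p
  note d = map_poly_derivation[of "pderiv_xy i", OF pderiv_xy_derivation]
  have add: "G (p + q) = G p + G q" for p q
    by (simp add: G_def d pderiv_add algebra_simps)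
  have mult: "G (p * q) = G p * to_loc (sphere_of q) + to_loc (sphere_of p) * G q" for p q
    by (simp add: G_def d pderiv_mult algebra_simps)
  have sp: "sphere_poly = ([:[:[:-1, 0, 1:], 0, 1:], 0, 1:] :: 'k poly poly poly)"
    by (simp add: sphere_poly_def poly_x_def poly_y_def poly_z_def power2_eq_square one_pCons)
  let ?t = "if i = 1 then poly_x else poly_y :: 'k poly poly poly"
  have sp_xy: "map_poly (pderiv_xy i) sphere_poly = ?t + ?t"
    unfolding sp 
    by (simp add: pderiv_xy_def poly_x_def poly_y_def map_poly_pCons pderiv_pCons one_pCons
        numeral_poly)
  have sp_z: "pderiv sphere_poly = (poly_z + poly_z :: 'k poly poly poly)"
    unfolding sp by (simp add: poly_z_def pderiv_pCons)
  have t: "sphere_of ?t = t_var i" by (simp add: t_var_def sphere_x_def sphere_y_def)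
  have "to_loc (t_var i) * z_inv * (to_loc sphere_z + to_loc sphere_z) =
      to_loc (t_var i) * (to_loc sphere_z * z_inv) + to_loc (t_var i) * (to_loc sphere_z * z_inv)"
    by (simp only: algebra_simps)
  note cancel = this
  have G_sp: "G sphere_poly = 0"
    unfolding G_def sp_xy sp_z sphere_of_hom to_loc_hom t sphere_z_def[symmetric] cancel by simp
  have sphere_of_sp: "sphere_of sphere_poly = (0 :: 'k sphere)"
    using sphere_of_eq_iff[of sphere_poly 0] by simp
  have wd: "G p = G q" if eq: "sphere_of p = sphere_of q" for p q
  proof -
    from eq obtain r where "p - q = sphere_poly * r"
      unfolding sphere_of_eq_iff by (elim dvdE)
    then have "p = sphere_poly * r + q" by (simp add: algebra_simps)
    then show ?thesis by (simp add: add mult G_sp sphere_of_sp)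
  qed
  define \<delta> where "\<delta> a = (THE h. \<exists>p. a = sphere_of p \<and> h = G p)" for a
  have \<delta>: "\<delta> (sphere_of p) = G p" for p
    unfolding \<delta>_def by (rule the_equality, blast, clarify, erule wd[symmetric])
  have \<delta>_add: "\<delta> (a + b) = \<delta> a + \<delta> b" for a b
    by (cases a rule: sphere_cases, cases b rule: sphere_cases)
      (simp add: \<delta> add flip: sphere_of_hom(3))
  have \<delta>_mult: "\<delta> (a * b) = \<delta> a * to_loc b + to_loc a * \<delta> b" for a b
  proof (cases a rule: sphere_cases, cases b rule: sphere_cases)
    fix p q assume ab: "a = sphere_of p" "b = sphere_of q"
    then have "\<delta> (a * b) = G (p * q)" by (simp add: \<delta> flip: sphere_of_hom(4))
    then show ?thesis by (simp add: ab mult \<delta>)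
  qed
  have "\<delta> (sphere_const c) = 0" for c
    by (simp add: sphere_const_def \<delta> G_def map_poly_pCons pderiv_pCons pderiv_xy_def)
  then have \<delta>_scale: "\<delta> (sphere_const c * a) = loc_const c * \<delta> a" for c a
    by (simp add: \<delta>_mult loc_const_def)
  obtain D where D: "derivation loc_const D" "\<And>a. D (to_loc a) = \<delta> a"
    using derivation_extends_to_loc[OF \<delta>_add \<delta>_scale \<delta>_mult] by blast
  show ?thesis
  proof (rule that)
    show "D (of_poly_xy p) = of_poly_xy (pderiv_xy i p)" for p
      by (simp add: of_poly_xy_def D \<delta> G_def map_poly_pCons pderiv_xy_derivation pderiv_pCons)
    show "D (to_loc sphere_z) = - to_loc (t_var i) * z_inv"
      by (simp add: D sphere_z_def \<delta> G_def poly_z_def map_poly_pCons pderiv_xy_derivation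
          pderiv_pCons)
        (simp add: pderiv_xy_def map_poly_1 flip: one_pCons)
  qed (rule D(1))
qed

lemma to_loc_xy: "to_loc sphere_x = of_poly_xy [:[:0, 1:]:]" "to_loc sphere_y = of_poly_xy [:0, 1:]"
  by (simp_all add: of_poly_xy_def sphere_x_def sphere_y_def poly_x_def poly_y_def)

lemma of_poly_xy_01: "of_poly_xy 0 = 0" "of_poly_xy 1 = 1"
  by (simp_all add: of_poly_xy_def flip: one_pCons)

lemma partial_ex1:
  "\<exists>!D :: 'k::field_char_0 sphere_loc \<Rightarrow> 'k sphere_loc.
    derivation loc_const D \<and> (\<forall>p. D (of_poly_xy p) = of_poly_xy (pderiv_xy i p))"
proof (rule ex_ex1I)
  show "\<exists>D :: 'k sphere_loc \<Rightarrow> 'k sphere_loc.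
      derivation loc_const D \<and> (\<forall>p. D (of_poly_xy p) = of_poly_xy (pderiv_xy i p))"
    using partial_exists by metis
qed (simp add: derivation_eqI to_loc_xy)

lemma
  shows derivation_partial: "derivation loc_const (partial i :: 'k::field_char_0 sphere_loc \<Rightarrow> _)"
    and partial_of_poly_xy: "partial i (of_poly_xy p :: 'k sphere_loc) = of_poly_xy (pderiv_xy i p)"
  using theI'[OF partial_ex1[where 'k = 'k], of i] by (simp_all add: partial_def)

lemma partial_z:
  "partial i (to_loc sphere_z) = - to_loc (t_var i) * (z_inv :: 'k::field_char_0 sphere_loc)"
proof -
  obtain D :: "'k sphere_loc \<Rightarrow> 'k sphere_loc" where D: "derivation loc_const D"
    "\<And>p. D (of_poly_xy p) = of_poly_xy (pderiv_xy i p)"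
    "D (to_loc sphere_z) = - to_loc (t_var i) * z_inv"
    using partial_exists by metis
  have "D = partial i"
    by (rule derivation_eqI)
      (simp_all add: D derivation_partial partial_of_poly_xy to_loc_xy)
  with D(3) show ?thesis by simp
qed

lemma partial_xy:
  "partial (Suc 0) (to_loc sphere_x) = (1 :: 'k::field_char_0 sphere_loc)"
  "partial (Suc 0) (to_loc sphere_y) = (0 :: 'k sphere_loc)"
  "partial 2 (to_loc sphere_x) = (0 :: 'k sphere_loc)"
  "partial 2 (to_loc sphere_y) = (1 :: 'k sphere_loc)"
  unfolding to_loc_xy partial_of_poly_xy
  by (simp_all add: pderiv_xy_def map_poly_pCons pderiv_pCons of_poly_xy_01 map_poly_1
      flip: one_pCons)

text \<open>Every derivation of the localization is a combination of the two partial derivatives;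
  in particular \<open>\<eta> \<in> Der\<close>, extended to the localization, equals
  \<open>\<eta>(x) \<partial>/\<partial>x + \<eta>(y) \<partial>/\<partial>y\<close>.\<close>

lemma derivation_loc_conv:
  fixes D :: "'k::field_char_0 sphere_loc \<Rightarrow> 'k sphere_loc"
  assumes "derivation loc_const D"
  shows "D g = (\<Sum>i\<in>{1,2}. D (to_loc (t_var i)) * partial i g)"
proof -
  have "D = (\<lambda>g. D (to_loc sphere_x) * partial 1 g + D (to_loc sphere_y) * partial 2 g)"
    by (rule derivation_eqI[OF assms])
      (auto intro: derivation_lincomb derivation_partial simp: partial_xy)
  from fun_cong[OF this, of g] show ?thesis by (simp add: t_var_def)
qed

lemma Der_conv_partial:
  fixes \<eta> :: "'k::field_char_0 sphere \<Rightarrow> 'k sphere"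
  assumes "\<eta> \<in> Der"
  shows "to_loc (\<eta> a) = (\<Sum>i\<in>{1,2}. to_loc (\<eta> (t_var i)) * partial i (to_loc a))"
proof -
  from assms have \<eta>: "derivation sphere_const \<eta>" by (simp add: Der_def)
  obtain D where D: "derivation loc_const D" "\<And>a. D (to_loc a) = to_loc (\<eta> a)"
    by (rule derivation_extends_to_loc[of "\<lambda>a. to_loc (\<eta> a)"])
      (auto simp: derivation_add[OF \<eta>] derivation_scale[OF \<eta>] derivation_mult[OF \<eta>]
        derivation_const[OF \<eta>] loc_const_def)
  from derivation_loc_conv[OF D(1), of "to_loc a"] show ?thesis by (simp add: D(2))
qed

section \<open>The modules\<close>

text \<open>\<open>U\<close> consists of the functions supported on \<open>{0..m}\<close>, a function \<open>u\<close> standing for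
  \<open>\<Sum>j\<le>m. u j v\<^sub>j\<close>. The index of \<open>v\<close> is an integer, so that \<open>v\<^sub>-\<^sub>1 = v\<^sub>m\<^sub>+\<^sub>1 = 0\<close>.\<close>

definition supp :: "nat \<Rightarrow> (nat \<Rightarrow> 'r::zero) set" where
  "supp m = {w. \<forall>j>m. w j = 0}"

definition v_basis :: "nat \<Rightarrow> int \<Rightarrow> nat \<Rightarrow> 'k::field" where
  "v_basis m i = (\<lambda>j. if i = int j \<and> j \<le> m then 1 else 0)"

definition scale :: "'r::times \<Rightarrow> (nat \<Rightarrow> 'r) \<Rightarrow> nat \<Rightarrow> 'r" where
  "scale c u = (\<lambda>j. c * u j)"

text \<open>\<open>E_basis m \<alpha> p q i\<close> is the image of \<open>v\<^sub>i\<close> under the matrix unit \<open>E\<^sub>p\<^sub>,\<^sub>q\<close>, for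
  \<open>p\<close> and \<open>q\<close> in \<open>{1,2}\<close>.\<close>

definition E_basis :: "nat \<Rightarrow> 'k::field \<Rightarrow> nat \<Rightarrow> nat \<Rightarrow> nat \<Rightarrow> nat \<Rightarrow> 'k" where
  "E_basis m \<alpha> p q i =
    (if (p, q) = (1, 1) then scale ((\<alpha> + of_nat m - 2 * of_nat i) / 2) (v_basis m (int i))
     else if (p, q) = (1, 2) then scale (of_nat m - of_nat i + 1) (v_basis m (int i - 1))
     else if (p, q) = (2, 1) then scale (of_nat i + 1) (v_basis m (int i + 1))
     else scale ((\<alpha> - of_nat m + 2 * of_nat i) / 2) (v_basis m (int i)))"

definition E_act :: "nat \<Rightarrow> 'k::field \<Rightarrow> nat \<Rightarrow> nat \<Rightarrow> (nat \<Rightarrow> 'k) \<Rightarrow> nat \<Rightarrow> 'k" where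
  "E_act m \<alpha> p q u = (\<Sum>i\<le>m. scale (u i) (E_basis m \<alpha> p q i))"

text \<open>As \<open>U\<close> has the basis \<open>v\<^sub>0, \<dots>, v\<^sub>m\<close>, the tensor product of the localization with \<open>U\<close> is
  the set \<open>supp m\<close> of families of elements of the localization, with the following pure
  tensors.\<close>

definition tens :: "'k::field sphere_loc \<Rightarrow> (nat \<Rightarrow> 'k) \<Rightarrow> nat \<Rightarrow> 'k sphere_loc" (infixl "\<otimes>" 70)
  where "g \<otimes> u = (\<lambda>j. g * loc_const (u j))"

definition A_act :: "'k::field sphere \<Rightarrow> (nat \<Rightarrow> 'k sphere_loc) \<Rightarrow> nat \<Rightarrow> 'k sphere_loc" where
  "A_act a w = scale (to_loc a) w"

definition V_act_tens ::
  "nat \<Rightarrow> 'k::field \<Rightarrow> (nat \<Rightarrow> 'k sphere_loc) \<Rightarrow> 'k sphere_loc \<Rightarrow> (nat \<Rightarrow> 'k) \<Rightarrow> nat \<Rightarrow> 'k sphere_loc"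
  where "V_act_tens m \<alpha> f g u =
    (\<Sum>i\<in>{1,2}. (f i * partial i g) \<otimes> u) +
    (\<Sum>p\<in>{1,2}. \<Sum>i\<in>{1,2}. (g * partial p (f i)) \<otimes> E_act m \<alpha> p i u)"

definition V_act ::
  "nat \<Rightarrow> 'k::field \<Rightarrow> ('k sphere \<Rightarrow> 'k sphere) \<Rightarrow> (nat \<Rightarrow> 'k sphere_loc) \<Rightarrow> nat \<Rightarrow> 'k sphere_loc"
  where "V_act m \<alpha> \<eta> w =
    (\<Sum>j\<le>m. V_act_tens m \<alpha> (\<lambda>i. to_loc (\<eta> (t_var i))) (w j) (v_basis m (int j)))"


lemma tens_bilinear:
  "(g + h) \<otimes> u = g \<otimes> u + h \<otimes> u" "g \<otimes> (u + v) = g \<otimes> u + g \<otimes> v"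
  "(loc_const c * g) \<otimes> u = scale (loc_const c) (g \<otimes> u)" "g \<otimes> scale c u = scale (loc_const c) (g \<otimes> u)"
  by (simp_all add: tens_def scale_def fun_eq_iff algebra_simps)

lemma sum_apply: "(\<Sum>i\<in>S. f i) (j :: nat) = (\<Sum>i\<in>S. f i j)"
  for f :: "'i \<Rightarrow> nat \<Rightarrow> 'r::comm_monoid_add"
  by (induction S rule: infinite_finite_induct) simp_all

lemma tens_expansion: "w \<in> supp m \<Longrightarrow> w = (\<Sum>j\<le>m. w j \<otimes> v_basis m (int j))"
proof
  fix l assume "w \<in> supp m"
  have "(\<Sum>j\<le>m. w j \<otimes> v_basis m (int j)) l = (\<Sum>j\<le>m. if j = l then w j else 0)"
    unfolding sum_apply by (intro sum.cong) (auto simp: tens_def v_basis_def)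
  then show "w l = (\<Sum>j\<le>m. w j \<otimes> v_basis m (int j)) l"
    using \<open>w \<in> supp m\<close> by (simp add: supp_def)
qed

lemma E_act_apply: "E_act m \<alpha> p q u l = (\<Sum>j\<le>m. u j * E_basis m \<alpha> p q j l)"
  by (simp add: E_act_def sum_apply scale_def)

lemma E_act_v_basis:
  assumes "j \<le> m"
  shows "E_act m \<alpha> p q (v_basis m (int j)) = E_basis m \<alpha> p q j"
proof
  fix l
  have "E_act m \<alpha> p q (v_basis m (int j)) l = (\<Sum>i\<le>m. if i = j then E_basis m \<alpha> p q i l else 0)"
    unfolding E_act_apply by (intro sum.cong) (auto simp: v_basis_def)
  with assms show "E_act m \<alpha> p q (v_basis m (int j)) l = E_basis m \<alpha> p q j l" by simp
qed

lemma loc_const_sum: "loc_const (sum f S) = (\<Sum>i\<in>S. loc_const (f i))"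
  by (induction S rule: infinite_finite_induct) simp_all

definition E_loc ::
  "nat \<Rightarrow> 'k::field \<Rightarrow> nat \<Rightarrow> nat \<Rightarrow> (nat \<Rightarrow> 'k sphere_loc) \<Rightarrow> nat \<Rightarrow> 'k sphere_loc" where
  "E_loc m \<alpha> p q w l = (\<Sum>j\<le>m. w j * loc_const (E_basis m \<alpha> p q j l))"

lemma E_loc_tens: "E_loc m \<alpha> p q (g \<otimes> u) = g \<otimes> E_act m \<alpha> p q u"
  by (simp add: fun_eq_iff E_loc_def tens_def E_act_apply loc_const_sum sum_distrib_left mult.assoc)

lemma E_loc_supp: "E_loc m \<alpha> p q w \<in> supp m"
  by (auto simp: supp_def E_loc_def E_basis_def scale_def v_basis_def intro!: sum.neutral)

lemma V_act_apply:
  fixes \<alpha> :: "'k::field_char_0"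
  assumes "w \<in> supp m"
  shows "V_act m \<alpha> \<eta> w l = (\<Sum>i\<in>{1,2}. to_loc (\<eta> (t_var i)) * partial i (w l)) +
    (\<Sum>p\<in>{1,2}. \<Sum>i\<in>{1,2}. partial p (to_loc (\<eta> (t_var i))) * E_loc m \<alpha> p i w l)"
proof -
  let ?f = "\<lambda>i. to_loc (\<eta> (t_var i))"
  have d0: "partial i (0 :: 'k sphere_loc) = 0" for i by (rule derivation_0[OF derivation_partial])
  have 1: "(\<Sum>j\<le>m. c j * loc_const (v_basis m (int j) l)) = c l"
    if "l > m \<Longrightarrow> c l = 0" for c
  proof -
    have "(\<Sum>j\<le>m. c j * loc_const (v_basis m (int j) l)) = (\<Sum>j\<le>m. if j = l then c j else 0)"
      by (intro sum.cong) (auto simp: v_basis_def)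
    with that show ?thesis by auto
  qed
  have "V_act m \<alpha> \<eta> w l = (\<Sum>j\<le>m. ((\<Sum>i\<in>{1,2}. ?f i * partial i (w j))) * loc_const (v_basis m (int j) l)) +
      (\<Sum>p\<in>{1,2}. \<Sum>i\<in>{1,2}. partial p (?f i) * E_loc m \<alpha> p i w l)"
    by (simp add: V_act_def V_act_tens_def sum_apply tens_def E_act_v_basis E_loc_def
        sum_distrib_left sum.distrib algebra_simps)
  also have "(\<Sum>j\<le>m. ((\<Sum>i\<in>{1,2}. ?f i * partial i (w j))) * loc_const (v_basis m (int j) l)) =
      (\<Sum>i\<in>{1,2}. ?f i * partial i (w l))"
    by (rule 1) (use assms in \<open>simp add: supp_def d0\<close>)
  finally show ?thesis .
qed

lemma V_act_pure:
  fixes \<alpha> :: "'k::field_char_0"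
  assumes "u \<in> supp m"
  shows "V_act m \<alpha> \<eta> (g \<otimes> u) = V_act_tens m \<alpha> (\<lambda>i. to_loc (\<eta> (t_var i))) g u"
proof
  fix l
  have "g \<otimes> u \<in> supp m" using assms by (simp add: supp_def tens_def)
  moreover have "partial i (g * loc_const c) = partial i g * loc_const c" for i and c :: 'k
    by (simp add: derivation_mult[OF derivation_partial] derivation_const[OF derivation_partial])
  ultimately show "V_act m \<alpha> \<eta> (g \<otimes> u) l = V_act_tens m \<alpha> (\<lambda>i. to_loc (\<eta> (t_var i))) g u l"
    by (simp add: V_act_apply E_loc_tens V_act_tens_def sum_apply)
      (simp add: tens_def algebra_simps)
qed

lemma E_loc_linear:
  "E_loc m \<alpha> p q (\<lambda>l. w l + w' l) l = E_loc m \<alpha> p q w l + E_loc m \<alpha> p q w' l"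
  "E_loc m \<alpha> p q (\<lambda>l. g * w l) l = g * E_loc m \<alpha> p q w l"
  by (simp_all add: E_loc_def sum.distrib sum_distrib_left algebra_simps)

lemma derivation_E_loc:
  assumes "derivation loc_const D"
  shows "D (E_loc m \<alpha> p q w l) = E_loc m \<alpha> p q (\<lambda>l. D (w l)) l"
proof -
  have "D (sum f S) = (\<Sum>i\<in>S. D (f i))" if "finite S" for f and S :: "nat set"
    using that by (induction S) (simp_all add: derivation_0[OF assms] derivation_add[OF assms])
  then show ?thesis
    by (simp add: E_loc_def derivation_mult[OF assms] derivation_const[OF assms])
qed

lemma E_loc_apply:
  assumes "w \<in> supp m" "l \<le> m"
  shows "E_loc m \<alpha> (Suc 0) (Suc 0) w l = loc_const ((\<alpha> + of_nat m - 2 * of_nat l) / 2) * w l"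
    and "E_loc m \<alpha> (Suc 0) 2 w l = loc_const (of_nat m - of_nat l) * w (Suc l)"
    and "E_loc m \<alpha> 2 (Suc 0) w l = loc_const (of_nat l) * w (l - 1)"
    and "E_loc m \<alpha> 2 2 w l = loc_const ((\<alpha> - of_nat m + 2 * of_nat l) / 2) * w l"
proof -
  have single: "E_loc m \<alpha> p q w l = c i * w i"
    if "\<And>j. j \<le> m \<Longrightarrow> j \<noteq> i \<Longrightarrow> E_basis m \<alpha> p q j l = 0"
      "i \<le> m \<Longrightarrow> loc_const (E_basis m \<alpha> p q i l) = c i" for p q c i
  proof -
    have "E_loc m \<alpha> p q w l = (\<Sum>j\<le>m. if j = i then c j * w j else 0)"
      unfolding E_loc_def by (intro sum.cong) (use that in \<open>auto simp: mult.commute\<close>)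
    then show ?thesis using assms(1) by (auto simp: supp_def not_le)
  qed
  show "E_loc m \<alpha> (Suc 0) (Suc 0) w l = loc_const ((\<alpha> + of_nat m - 2 * of_nat l) / 2) * w l"
    by (rule single) (use assms in \<open>auto simp: E_basis_def scale_def v_basis_def\<close>)
  show "E_loc m \<alpha> 2 2 w l = loc_const ((\<alpha> - of_nat m + 2 * of_nat l) / 2) * w l"
    by (rule single) (use assms in \<open>auto simp: E_basis_def scale_def v_basis_def\<close>)
  show "E_loc m \<alpha> (Suc 0) 2 w l = loc_const (of_nat m - of_nat l) * w (Suc l)"
    by (rule single) (use assms in \<open>auto simp: E_basis_def scale_def v_basis_def\<close>)
  show "E_loc m \<alpha> 2 (Suc 0) w l = loc_const (of_nat l) * w (l - 1)"
  proof (cases l)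
    case 0
    then show ?thesis
      by (auto simp: E_loc_def E_basis_def scale_def v_basis_def intro!: sum.neutral)
  next
    case (Suc l')
    show ?thesis
      by (rule single) (use assms Suc in \<open>auto simp: E_basis_def scale_def v_basis_def\<close>)
  qed
qed

lemma v_basis_outside: "m < l \<Longrightarrow> v_basis m i l = 0"
  by (simp add: v_basis_def)

lemma E_basis_outside: "m < l \<Longrightarrow> E_basis m \<alpha> p q i l = 0"
  by (simp add: E_basis_def scale_def v_basis_outside)

lemma V_act_supp: "V_act m \<alpha> \<eta> w \<in> supp m"
  by (simp add: supp_def V_act_def V_act_tens_def sum_apply tens_def E_act_v_basis
      E_basis_outside v_basis_outside)

lemma A_act_supp: "w \<in> supp m \<Longrightarrow> A_act a w \<in> supp m"
  by (simp add: supp_def A_act_def scale_def)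

lemma V_act_A_act:
  fixes \<alpha> :: "'k::field_char_0"
  assumes "\<eta> \<in> Der" "w \<in> supp m"
  shows "V_act m \<alpha> \<eta> (A_act a w) = A_act (\<eta> a) w + A_act a (V_act m \<alpha> \<eta> w)"
proof
  fix l
  show "V_act m \<alpha> \<eta> (A_act a w) l = (A_act (\<eta> a) w + A_act a (V_act m \<alpha> \<eta> w)) l"
    using assms(2)
    by (simp add: V_act_apply A_act_supp)
      (simp add: V_act_apply A_act_def scale_def E_loc_linear Der_conv_partial[OF assms(1), of a]
        derivation_mult[OF derivation_partial] algebra_simps)
qed

lemma partial_commute: "partial (Suc 0) (partial 2 g) = partial 2 (partial (Suc 0) g)"
  for g :: "'k::field_char_0 sphere_loc"
proof -
  let ?D = "\<lambda>g :: 'k sphere_loc. partial (Suc 0) (partial 2 g) - partial 2 (partial (Suc 0) g)"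
  note d = derivation_add[OF derivation_partial] derivation_mult[OF derivation_partial]
    derivation_scale[OF derivation_partial] derivation_0[OF derivation_partial]
    derivation_1[OF derivation_partial] derivation_const[OF derivation_partial]
  have "derivation loc_const ?D"
    unfolding derivation_def by (simp add: d) (simp add: algebra_simps)
  from derivation_eq_0_on_sphere[OF this, of g] show ?thesis
    by (simp add: partial_xy d)
qed

lemma Der_bracket:
  assumes "\<eta> \<in> Der" "\<mu> \<in> Der"
  shows "(\<lambda>a. \<eta> (\<mu> a) - \<mu> (\<eta> a)) \<in> Der"
proof -
  from assms have *: "derivation sphere_const \<eta>" "derivation sphere_const \<mu>"
    by (simp_all add: Der_def)
  have "derivation sphere_const (\<lambda>a. \<eta> (\<mu> a) - \<mu> (\<eta> a))"
    unfolding derivation_def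
    by (simp only: *[THEN derivation_add] *[THEN derivation_scale] *[THEN derivation_mult])
      (simp add: *[THEN derivation_const] *[THEN derivation_0] algebra_simps)
  then show ?thesis by (simp add: Der_def)
qed

lemma E_loc_commutators:
  fixes \<alpha> :: "'k::field_char_0"
  assumes w: "w \<in> supp m" and l: "l \<le> m"
  defines "E \<equiv> E_loc m \<alpha>"
  shows "E (Suc 0) (Suc 0) (E (Suc 0) 2 w) l = E (Suc 0) 2 (E (Suc 0) (Suc 0) w) l + E (Suc 0) 2 w l"
    and "E (Suc 0) (Suc 0) (E 2 (Suc 0) w) l = E 2 (Suc 0) (E (Suc 0) (Suc 0) w) l - E 2 (Suc 0) w l"
    and "E (Suc 0) (Suc 0) (E 2 2 w) l = E 2 2 (E (Suc 0) (Suc 0) w) l"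
    and "E 2 2 (E (Suc 0) 2 w) l = E (Suc 0) 2 (E 2 2 w) l - E (Suc 0) 2 w l"
    and "E 2 2 (E 2 (Suc 0) w) l = E 2 (Suc 0) (E 2 2 w) l + E 2 (Suc 0) w l"
    and "E (Suc 0) 2 (E 2 (Suc 0) w) l =
      E 2 (Suc 0) (E (Suc 0) 2 w) l + E (Suc 0) (Suc 0) w l - E 2 2 w l"
proof -
  define a where "a j = loc_const ((\<alpha> + of_nat m - 2 * of_nat j) / 2)" for j
  define b where "b j = loc_const ((\<alpha> - of_nat m + 2 * of_nat j) / 2)" for j
  define c :: "nat \<Rightarrow> 'k sphere_loc" where "c j = loc_const (of_nat j)" for j
  have E: "E (Suc 0) (Suc 0) u j = a j * u j" "E (Suc 0) 2 u j = (c m - c j) * u (Suc j)"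
      "E 2 (Suc 0) u j = c j * u (j - 1)" "E 2 2 u j = b j * u j"
    if "u \<in> supp m" "j \<le> m" for u j
    using that by (simp_all add: E_def E_loc_apply a_def b_def c_def)
  have E_supp: "E p q u \<in> supp m" for p q u by (simp add: E_def E_loc_supp)
  have eqI: "loc_const x = loc_const y + 1" if "x = y + 1" for x y :: 'k
    using that by simp
  have a_Suc: "a j = a (Suc j) + 1" for j
    unfolding a_def by (rule eqI) (simp add: field_simps)
  have a_Suc': "a (Suc j) = a j - 1" for j
    by (simp add: a_Suc[of j])
  have b_Suc: "b (Suc j) = b j + 1" for j
    unfolding b_def by (rule eqI) (simp add: field_simps)
  have c_Suc: "c (Suc j) = c j + 1" for j
    unfolding c_def by (rule eqI) simp
  have c_0: "c 0 = 0" by (simp add: c_def)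
  have ab: "a j = b j + c m - c j - c j" for j
    unfolding a_def b_def c_def by (simp add: field_simps flip: loc_const_hom(3) loc_const_minus(2))
  show 1: "E (Suc 0) (Suc 0) (E (Suc 0) 2 w) l = E (Suc 0) 2 (E (Suc 0) (Suc 0) w) l + E (Suc 0) 2 w l"
    using l by (cases "l = m") (simp_all add: E E_supp w a_Suc[of l] algebra_simps)
  show "E 2 2 (E (Suc 0) 2 w) l = E (Suc 0) 2 (E 2 2 w) l - E (Suc 0) 2 w l"
    using l by (cases "l = m") (simp_all add: E E_supp w b_Suc[of l] algebra_simps)
  show "E (Suc 0) (Suc 0) (E 2 2 w) l = E 2 2 (E (Suc 0) (Suc 0) w) l"
    using l by (simp add: E E_supp w algebra_simps)
  show "E (Suc 0) (Suc 0) (E 2 (Suc 0) w) l = E 2 (Suc 0) (E (Suc 0) (Suc 0) w) l - E 2 (Suc 0) w l"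
    using l by (cases l) (simp_all add: E E_supp w c_0 a_Suc' algebra_simps)
  show "E 2 2 (E 2 (Suc 0) w) l = E 2 (Suc 0) (E 2 2 w) l + E 2 (Suc 0) w l"
    using l by (cases l) (simp_all add: E E_supp w c_0 b_Suc algebra_simps)
  have 2: "E (Suc 0) 2 (E 2 (Suc 0) w) l = (c m - c l) * (c l + 1) * w l"
  proof (cases "l = m")
    case True
    then show ?thesis using E(2)[OF E_supp l] by simp
  next
    case False
    with l show ?thesis by (simp add: E E_supp w c_Suc algebra_simps)
  qed
  have 3: "E 2 (Suc 0) (E (Suc 0) 2 w) l = c l * (c m - c l + 1) * w l"
  proof (cases l)
    case 0
    then show ?thesis using E(3)[OF E_supp l] by (simp add: c_0)
  next
    case (Suc j)
    with l show ?thesis by (simp add: E E_supp w c_Suc algebra_simps)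
  qed
  show "E (Suc 0) 2 (E 2 (Suc 0) w) l =
      E 2 (Suc 0) (E (Suc 0) 2 w) l + E (Suc 0) (Suc 0) w l - E 2 2 w l"
    by (simp add: 2 3 E(1,4) w l ab algebra_simps)
qed

lemma V_act_bracket:
  fixes \<alpha> :: "'k::field_char_0"
  assumes "\<eta> \<in> Der" "\<mu> \<in> Der" "w \<in> supp m"
  shows "V_act m \<alpha> (\<lambda>a. \<eta> (\<mu> a) - \<mu> (\<eta> a)) w =
    V_act m \<alpha> \<eta> (V_act m \<alpha> \<mu> w) - V_act m \<alpha> \<mu> (V_act m \<alpha> \<eta> w)"
proof
  fix l
  define f where "f i = to_loc (\<eta> (t_var i))" for i
  define g where "g i = to_loc (\<mu> (t_var i))" for i
  note d = derivation_add[OF derivation_partial] derivation_mult[OF derivation_partial]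
  have diff: "partial i (a - b) = partial i a - partial i b" for i and a b :: "'k sphere_loc"
    using derivation_add[OF derivation_partial, of i "a - b" b] by (simp add: algebra_simps)
  have bracket: "to_loc (\<eta> (\<mu> (t_var i)) - \<mu> (\<eta> (t_var i))) =
      (f (Suc 0) * partial (Suc 0) (g i) + f 2 * partial 2 (g i)) -
      (g (Suc 0) * partial (Suc 0) (f i) + g 2 * partial 2 (f i))" for i
    using Der_conv_partial[OF assms(1), of "\<mu> (t_var i)"]
      Der_conv_partial[OF assms(2), of "\<eta> (t_var i)"]
    by (simp add: f_def g_def)
  define E where "E = E_loc m \<alpha>"
  have E_linear: "E p q (\<lambda>l. u l + u' l) l = E p q u l + E p q u' l"
    "E p q (\<lambda>l. b * u l) l = b * E p q u l" for p q u u' b l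
    by (simp_all add: E_def E_loc_linear)
  have d_E: "partial i (E p q u l) = E p q (\<lambda>l. partial i (u l)) l" for i p q u l
    by (simp add: E_def derivation_E_loc[OF derivation_partial])
  have V: "V_act m \<alpha> \<zeta> u = (\<lambda>l.
      (h (Suc 0) * partial (Suc 0) (u l) + h 2 * partial 2 (u l)) +
      ((partial (Suc 0) (h (Suc 0)) * E (Suc 0) (Suc 0) u l + partial (Suc 0) (h 2) * E (Suc 0) 2 u l) +
       (partial 2 (h (Suc 0)) * E 2 (Suc 0) u l + partial 2 (h 2) * E 2 2 u l)))"
    if "u \<in> supp m" "\<And>i. to_loc (\<zeta> (t_var i)) = h i" for \<zeta> u h
    by (simp add: fun_eq_iff V_act_apply that E_def)
  note V\<eta> = V[where \<zeta> = \<eta> and h = f, OF _ f_def[symmetric]]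
  note V\<mu> = V[where \<zeta> = \<mu> and h = g, OF _ g_def[symmetric]]
  note V_bracket = V[OF assms(3), where \<zeta> = "\<lambda>a. \<eta> (\<mu> a) - \<mu> (\<eta> a)" and
    h = "\<lambda>i. (f (Suc 0) * partial (Suc 0) (g i) + f 2 * partial 2 (g i)) -
      (g (Suc 0) * partial (Suc 0) (f i) + g 2 * partial 2 (f i))", OF bracket]
  show "V_act m \<alpha> (\<lambda>a. \<eta> (\<mu> a) - \<mu> (\<eta> a)) w l =
    (V_act m \<alpha> \<eta> (V_act m \<alpha> \<mu> w) - V_act m \<alpha> \<mu> (V_act m \<alpha> \<eta> w)) l"
  proof (cases "l \<le> m")
    case False
    then show ?thesis using V_act_supp[of m \<alpha>] by (simp add: supp_def)
  next
    case True
    note commutators = E_loc_commutators[OF assms(3) True, of \<alpha>, folded E_def]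
    show ?thesis
      unfolding minus_apply V\<eta>[OF V_act_supp] V\<mu>[OF V_act_supp]
      unfolding V\<eta>[OF assms(3)] V\<mu>[OF assms(3)] V_bracket
      by (simp only: E_linear d_E d diff commutators partial_commute) (simp only: algebra_simps)
  qed
qed

text \<open>Closure under the action of \<open>A\<close> includes closure under scalars.\<close>

definition AV_submodule :: "nat \<Rightarrow> 'k::field \<Rightarrow> (nat \<Rightarrow> 'k sphere_loc) set \<Rightarrow> bool" where
  "AV_submodule m \<alpha> M \<longleftrightarrow> M \<subseteq> supp m \<and> 0 \<in> M \<and>
    (\<forall>w\<in>M. \<forall>w'\<in>M. w + w' \<in> M) \<and>
    (\<forall>a. \<forall>w\<in>M. A_act a w \<in> M) \<and>
    (\<forall>\<eta>\<in>Der. \<forall>w\<in>M. V_act m \<alpha> \<eta> w \<in> M)"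

definition AV_generated ::
  "nat \<Rightarrow> 'k::field \<Rightarrow> (nat \<Rightarrow> 'k sphere_loc) \<Rightarrow> (nat \<Rightarrow> 'k sphere_loc) set" where
  "AV_generated m \<alpha> w = \<Inter> {M. AV_submodule m \<alpha> M \<and> w \<in> M}"

lemma AV_submodule_supp: "AV_submodule m \<alpha> (supp m)"
  unfolding AV_submodule_def
  by (intro conjI ballI allI order_refl V_act_supp A_act_supp) (simp_all add: supp_def)

definition z_filtration :: "nat \<Rightarrow> int \<Rightarrow> (nat \<Rightarrow> 'k::field sphere_loc) set" where
  "z_filtration m k = {w \<in> supp m. \<forall>j. \<exists>a. w j = z_pow k * to_loc a}"

text \<open>Lemma \<open>z_degree_iff\<close> below shows that the maximum defining the degree of a nonzero
  element exists.\<close>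

definition z_degree :: "nat \<Rightarrow> (nat \<Rightarrow> 'k::field sphere_loc) \<Rightarrow> int" where
  "z_degree m w = (GREATEST k. w \<in> z_filtration m k)"

definition bounded_AV_submodule ::
  "nat \<Rightarrow> 'k::field \<Rightarrow> (nat \<Rightarrow> 'k sphere_loc) set \<Rightarrow> bool" where
  "bounded_AV_submodule m \<alpha> M \<longleftrightarrow>
    AV_submodule m \<alpha> M \<and> M \<noteq> {0} \<and> bdd_below (z_degree m ` (M - {0}))"

subsection \<open>Existence of the degree\<close>

definition norm_s :: "'k::field poly poly" where
  "norm_s = [:[:1, 0, -1:], 0, -1:]"

definition normal_form :: "'k::field poly poly poly \<Rightarrow> 'k poly poly \<times> 'k poly poly" where
  "normal_form p = fold_coeffs (\<lambda>c (a, b). (c + norm_s * b, a)) p (0, 0)"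

lemma normal_form_0 [simp]: "normal_form 0 = (0, 0)"
  by (simp add: normal_form_def)

lemma normal_form_pCons:
  "normal_form (pCons c p) = (c + norm_s * snd (normal_form p), fst (normal_form p))"
  by (cases "c = 0 \<and> p = 0") (auto simp: normal_form_def split: prod.split)

lemma normal_form_add:
  "normal_form (p + q) =
    (fst (normal_form p) + fst (normal_form q), snd (normal_form p) + snd (normal_form q))"
  by (induction p q rule: poly_induct2) (simp_all add: normal_form_pCons algebra_simps)

lemma normal_form_smult:
  "normal_form (smult c p) = (c * fst (normal_form p), c * snd (normal_form p))"
  by (induction p) (simp_all add: normal_form_pCons algebra_simps)

lemma sphere_poly_norm_s: "sphere_poly = [:- norm_s, 0, 1:]"
  by (simp add: sphere_poly_def poly_x_def poly_y_def poly_z_def power2_eq_square one_pCons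
      norm_s_def)

lemma normal_form_sphere_mult: "normal_form (sphere_poly * r) = (0, 0)"
proof (induction r)
  case (pCons c r)
  have "sphere_poly * pCons c r = smult c sphere_poly + pCons 0 (sphere_poly * r)"
    by (simp add: mult_pCons_right)
  moreover have "normal_form (sphere_poly :: 'a poly poly poly) = (0, 0)"
    by (simp add: sphere_poly_norm_s normal_form_pCons)
  ultimately show ?case
    by (simp only: normal_form_add normal_form_smult normal_form_pCons pCons.IH) simp
qed simp

lemma sphere_poly_dvd_normal_form:
  "sphere_poly dvd p - [:fst (normal_form p), snd (normal_form p):]"
proof (induction p)
  case (pCons c p)
  let ?a = "fst (normal_form p)" and ?b = "snd (normal_form p)"
  have "pCons c p - [:fst (normal_form (pCons c p)), snd (normal_form (pCons c p)):] =
      [:0, 1:] * (p - [:?a, ?b:]) + sphere_poly * [:?b:]"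
    by (simp add: normal_form_pCons sphere_poly_norm_s algebra_simps)
  with pCons.IH show ?case by (simp only: dvd_add dvd_mult dvd_triv_left)
qed simp

lemma sphere_of_eq_0_iff: "sphere_of p = 0 \<longleftrightarrow> normal_form p = (0, 0)"
proof
  assume "sphere_of p = 0"
  then have "sphere_poly dvd p" using sphere_of_eq_iff[of p 0] by simp
  then show "normal_form p = (0, 0)" by (auto simp: normal_form_sphere_mult elim: dvdE)
next
  assume "normal_form p = (0, 0)"
  with sphere_poly_dvd_normal_form[of p] show "sphere_of p = 0"
    using sphere_of_eq_iff[of p 0] by simp
qed

lemma normal_form_cong:
  assumes "sphere_of p = sphere_of q"
  shows "normal_form p = normal_form q"
proof -
  from assms obtain r where "p - q = sphere_poly * r"
    unfolding sphere_of_eq_iff by (elim dvdE)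
  then have "p = sphere_poly * r + q" by (simp add: algebra_simps)
  then show ?thesis by (simp add: normal_form_add normal_form_sphere_mult)
qed

lemma norm_s_not_0: "norm_s \<noteq> 0"
  by (simp add: norm_s_def)

lemma normal_form_z_power:
  "normal_form (poly_z ^ (2 * k) * p) =
    (norm_s ^ k * fst (normal_form p), norm_s ^ k * snd (normal_form p))"
proof (induction k)
  case (Suc k)
  have "poly_z ^ (2 * Suc k) * p = pCons 0 (pCons 0 (poly_z ^ (2 * k) * p))"
    by (simp add: poly_z_def)
  with Suc show ?case by (simp add: normal_form_pCons algebra_simps)
qed simp

lemma sphere_of_power: "sphere_of (p ^ n) = sphere_of p ^ n"
  by (induction n) simp_all

lemma sphere_z_mult_eq_0_iff: "sphere_z * a = 0 \<longleftrightarrow> a = 0"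
proof (cases a rule: sphere_cases)
  fix p assume a: "a = sphere_of p"
  have "sphere_z * a = sphere_of (pCons 0 p)"
    using sphere_of_hom(4)[of poly_z p] by (simp add: a sphere_z_def poly_z_def)
  then show ?thesis
    by (auto simp: a sphere_of_eq_0_iff normal_form_pCons norm_s_not_0 prod_eq_iff)
qed

lemma to_loc_eq_iff: "to_loc a = to_loc b \<longleftrightarrow> a = b"
proof
  assume "to_loc a = to_loc b"
  then obtain k where "sphere_z ^ k * (a - b) = 0"
    by (auto simp: to_loc_def z_frac_eq_iff algebra_simps)
  then have "a - b = 0"
    by (induction k) (simp_all add: mult.assoc sphere_z_mult_eq_0_iff)
  then show "a = b" by simp
qed simp

lemma sphere_z_adic_separated:
  assumes "\<And>k. \<exists>b. a = sphere_z ^ (2 * k) * b"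
  shows "a = 0"
proof (cases a rule: sphere_cases)
  fix p assume a: "a = sphere_of p"
  have dvd: "norm_s ^ k dvd fst (normal_form p) \<and> norm_s ^ k dvd snd (normal_form p)" for k
  proof -
    obtain b where "a = sphere_z ^ (2 * k) * b" using assms by blast
    moreover obtain q where "b = sphere_of q" by (rule sphere_cases)
    ultimately have "sphere_of p = sphere_of (poly_z ^ (2 * k) * q)"
      by (simp add: a sphere_of_power sphere_z_def)
    then have "normal_form p = normal_form (poly_z ^ (2 * k) * q)" by (rule normal_form_cong)
    then show ?thesis by (simp add: normal_form_z_power)
  qed
  have deg: "degree (norm_s ^ k :: 'a poly poly) = 2 * k" for k
    by (simp add: degree_power_eq norm_s_not_0) (simp add: norm_s_def)
  have "c = 0" if "\<And>k. norm_s ^ k dvd c" for c :: "'a poly poly"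
    using dvd_imp_degree_le[OF that[of "Suc (degree c)"]] unfolding deg by auto
  with dvd show "a = 0"
    by (simp add: a sphere_of_eq_0_iff prod_eq_iff)
qed

lemma z_pow_diff: "z_pow (int a - int b) = to_loc sphere_z ^ a * (z_inv :: 'k::field sphere_loc) ^ b"
proof (induction a b rule: diff_induct)
  case (3 a b)
  have "to_loc sphere_z ^ Suc a * (z_inv :: 'k sphere_loc) ^ Suc b =
      (to_loc sphere_z * z_inv) * (to_loc sphere_z ^ a * z_inv ^ b)"
    by (simp only: power_Suc mult_ac)
  also have "\<dots> = to_loc sphere_z ^ a * z_inv ^ b" by simp
  finally show ?case using 3 by (simp del: power_Suc)
qed (simp_all add: z_pow_def nat_add_distrib flip: of_nat_Suc)

lemma z_pow_add: "z_pow (k + l) = z_pow k * z_pow l"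
proof -
  have *: "\<exists>a b. k = int a - int b" for k
    by (rule exI[of _ "nat k"], rule exI[of _ "nat (- k)"]) simp
  obtain a b c d where "k = int a - int b" "l = int c - int d" using * by metis
  moreover from this have "k + l = int (a + c) - int (b + d)" by simp
  ultimately show ?thesis by (simp only: z_pow_diff power_add mult_ac)
qed

lemma z_pow_nat: "z_pow (int n) = to_loc (sphere_z ^ n)" "z_pow (- int n) = z_inv ^ n"
  using z_pow_diff[of n 0] z_pow_diff[of 0 n] by simp_all

lemma z_filtration_antimono:
  assumes "k \<le> l"
  shows "z_filtration m l \<subseteq> (z_filtration m k :: (nat \<Rightarrow> 'k::field sphere_loc) set)"
proof -
  have "z_pow l = z_pow k * (to_loc (sphere_z ^ nat (l - k)) :: 'k sphere_loc)"
    unfolding z_pow_nat(1)[symmetric] z_pow_add[symmetric] using assms by simp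
  then have "z_pow l * to_loc a = z_pow k * to_loc (sphere_z ^ nat (l - k) * a)" for a :: "'k sphere"
    by (simp add: mult.assoc)
  then have "\<exists>b. z_pow l * to_loc a = z_pow k * to_loc b" for a :: "'k sphere" by blast
  then show ?thesis by (clarsimp simp: z_filtration_def) metis
qed

lemma z_filtration_exhaustive:
  assumes "w \<in> supp m"
  shows "\<exists>k. w \<in> z_filtration m k"
proof -
  have "\<forall>j. \<exists>n a. w j = z_frac a n" by (metis z_frac_cases)
  then obtain n a where na: "\<And>j. w j = z_frac (a j) (n j)" by metis
  define N where "N = Max (n ` {..m})"
  have "\<exists>b. w j = z_pow (- int N) * to_loc b" for j
  proof (cases "j \<le> m")
    case True
    then have "n j \<le> N" by (simp add: N_def)
    then have "z_frac (a j) (n j) = z_frac (sphere_z ^ (N - n j) * a j) N"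
      by (auto simp: z_frac_eq_iff simp flip: power_add mult.assoc)
    then have "w j = z_pow (- int N) * to_loc (sphere_z ^ (N - n j) * a j)"
      by (simp only: na z_frac_conv z_pow_nat mult.commute)
    then show ?thesis by blast
  next
    case False
    then have "w j = z_pow (- int N) * to_loc 0" using assms by (simp add: supp_def)
    then show ?thesis by blast
  qed
  with assms show ?thesis unfolding z_filtration_def by blast
qed

lemma z_filtration_separated:
  assumes "\<And>k. w \<in> z_filtration m k"
  shows "w = 0"
proof
  fix j
  obtain a n where w: "w j = z_frac a n" by (rule z_frac_cases)
  have "\<exists>b. a = sphere_z ^ (2 * k) * b" for k
  proof -
    obtain b where b: "w j = z_pow (int (2 * k) - int n) * to_loc b"
      using assms unfolding z_filtration_def by blast
    have Zn: "to_loc sphere_z ^ n * z_inv ^ n = 1" by (simp flip: power_mult_distrib)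
    have "to_loc a = (to_loc sphere_z ^ n * z_inv ^ n) * to_loc a" by (simp add: Zn)
    also have "\<dots> = to_loc sphere_z ^ n * w j" by (simp add: w z_frac_conv mult_ac)
    also have "\<dots> = (to_loc sphere_z ^ n * z_inv ^ n) * to_loc (sphere_z ^ (2 * k) * b)"
      unfolding b z_pow_diff to_loc_hom to_loc_power by (simp only: mult_ac)
    also have "\<dots> = to_loc (sphere_z ^ (2 * k) * b)" by (simp add: Zn)
    finally show ?thesis unfolding to_loc_eq_iff by blast
  qed
  then have "a = 0" by (rule sphere_z_adic_separated)
  then show "w j = 0 j" by (simp add: w z_frac_conv)
qed

lemma z_degree_iff:
  assumes "w \<in> supp m" "w \<noteq> 0"
  shows "w \<in> z_filtration m k \<longleftrightarrow> k \<le> z_degree m w"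
proof -
  obtain l where l: "w \<in> z_filtration m l" using z_filtration_exhaustive[OF assms(1)] by blast
  obtain u where u: "w \<notin> z_filtration m u" using z_filtration_separated assms(2) by blast
  have bound: "k < u" if "w \<in> z_filtration m k" for k
    using that u z_filtration_antimono[of u k m] by force
  define N where "N = Max {k \<in> {l..u}. w \<in> z_filtration m k}"
  have "finite {k \<in> {l..u}. w \<in> z_filtration m k}"
    by (rule finite_subset[of _ "{l..u}"]) auto
  moreover have "l \<in> {k \<in> {l..u}. w \<in> z_filtration m k}" using l bound[OF l] by simp
  ultimately have N: "w \<in> z_filtration m N" "\<And>k. k \<in> {l..u} \<Longrightarrow> w \<in> z_filtration m k \<Longrightarrow> k \<le> N"
    unfolding N_def using Max_in[of "{k \<in> {l..u}. w \<in> z_filtration m k}"] by auto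
  have "k \<le> N" if "w \<in> z_filtration m k" for k
  proof (cases "l \<le> k")
    case True
    with that bound[OF that] show ?thesis by (intro N(2)) auto
  next
    case False
    moreover have "l \<le> N" using l bound[OF l] by (intro N(2)) auto
    ultimately show ?thesis by simp
  qed
  with N(1) have "z_degree m w = N"
    unfolding z_degree_def by (intro Greatest_equality) auto
  with N(1) \<open>\<And>k. w \<in> z_filtration m k \<Longrightarrow> k \<le> N\<close> show ?thesis
    using z_filtration_antimono by blast
qed

lemma bounded_AV_submodule_iff:
  "bounded_AV_submodule m \<alpha> M \<longleftrightarrow>
    AV_submodule m \<alpha> M \<and> M \<noteq> {0} \<and> (\<exists>k. M \<subseteq> z_filtration m k)"
proof -
  have "bdd_below (z_degree m ` (M - {0})) \<longleftrightarrow> (\<exists>k. M \<subseteq> z_filtration m k)"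
    if M: "AV_submodule m \<alpha> M"
  proof -
    have supp: "w \<in> supp m" if "w \<in> M" for w using M that by (auto simp: AV_submodule_def)
    have zero: "0 \<in> z_filtration m k" for k
      unfolding z_filtration_def supp_def by (auto intro!: exI[of _ 0])
    have "(\<forall>w\<in>M - {0}. k \<le> z_degree m w) \<longleftrightarrow> M \<subseteq> z_filtration m k" for k
      using z_degree_iff[of _ m k] supp zero[of k] by blast
    then show ?thesis by (simp add: bdd_below_def)
  qed
  then show ?thesis by (simp add: bounded_AV_submodule_def cong: conj_cong)
qed

definition int_of :: "'k::ring_1 \<Rightarrow> int" where
  "int_of c = (THE n. of_int n = c)"

lemma int_of_of_int [simp]: "int_of (of_int n :: 'k::ring_char_0) = n"
  by (simp add: int_of_def)

text \<open>In \<open>w_gen\<close> the exponent of z is the integer whose image in the field is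
  \<open>-(\<alpha> + m)/2\<close>; it exists if and only if \<open>(m - \<alpha>)/2\<close> is an integer.\<close>

definition w_gen :: "nat \<Rightarrow> 'k::field \<Rightarrow> nat \<Rightarrow> 'k sphere_loc" where
  "w_gen m \<alpha> = (\<Sum>i\<le>m. (z_pow (int_of (- (\<alpha> + of_nat m) / 2)) *
    to_loc sphere_x ^ (m - i) * to_loc sphere_y ^ i) \<otimes> v_basis m (int i))"


end

theory Submission
  imports Defs
begin

text \<open>If \<open>c = (\<alpha> - m) / 2\<close> is an integer, \<open>v\<^sub>l\<close> may be read as \<open>(m choose l) dx\<^sup>m\<^sup>-\<^sup>l dy\<^sup>l (dx \<and> dy)\<^sup>c\<close>,
  and \<open>w\<^sub>m\<close> becomes, up to sign, \<open>(dz)\<^sup>m\<close> times the \<open>c\<close>-th power of the area form \<open>z\<^sup>-\<^sup>1 dx \<and> dy\<close>.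
  Products of \<open>m\<close> of the differentials \<open>dx\<close>, \<open>dy\<close>, \<open>dz\<close> with this power span over \<open>A\<close> a bounded
  submodule, because derivations of \<open>A\<close> have a divergence in \<open>A\<close>.

  Conversely, let \<open>w\<close> be of minimal degree \<open>d\<close> in a bounded submodule. The rotations \<open>z \<partial>/\<partial>x\<close> and
  \<open>z \<partial>/\<partial>y\<close> must not lower the degree, so the leading coefficients of \<open>w\<close> satisfy two recurrences
  modulo \<open>z\<close>. These force all of them to vanish unless \<open>d + (\<alpha> + m) / 2\<close> is an integer.\<close>

section \<open>Differentials\<close>

text \<open>The ring is generated over the field by x, y and z. The three inner inductions adjoin
  one variable of the iterated polynomials at a time, innermost first.\<close>

lemma sphere_induct [case_names const x y z add mult]:
  assumes const: "\<And>c. P (sphere_const c)" and x: "P sphere_x" and y: "P sphere_y" and z: "P sphere_z"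
    and add: "\<And>a b. P a \<Longrightarrow> P b \<Longrightarrow> P (a + b)" and mult: "\<And>a b. P a \<Longrightarrow> P b \<Longrightarrow> P (a * b)"
  shows "P (a :: 'k::field sphere)"
proof -
  have 1: "P (sphere_of [:[:p:]:])" for p
  proof (induction p)
    case 0
    show ?case using const[of 0] by (simp add: sphere_const_def)
  next
    case (pCons c p)
    have "[:[:pCons c p:]:] = [:[:[:c:]:]:] + poly_x * [:[:p:]:]" by (simp add: poly_x_def)
    then have "sphere_of [:[:pCons c p:]:] = sphere_const c + sphere_x * sphere_of [:[:p:]:]"
      by (simp only: sphere_of_hom sphere_const_def sphere_x_def)
    then show ?case using pCons.IH by (simp only: add mult const x)
  qed
  have 2: "P (sphere_of [:p:])" for p
  proof (induction p)
    case 0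
    show ?case using 1[of 0] by simp
  next
    case (pCons c p)
    have "[:pCons c p:] = [:[:c:]:] + poly_y * [:p:]" by (simp add: poly_y_def)
    then have "sphere_of [:pCons c p:] = sphere_of [:[:c:]:] + sphere_y * sphere_of [:p:]"
      by (simp only: sphere_of_hom sphere_y_def)
    then show ?case using pCons.IH by (simp only: add mult 1 y)
  qed
  have 3: "P (sphere_of p)" for p
  proof (induction p)
    case 0
    show ?case using 2[of 0] by simp
  next
    case (pCons c p)
    have "pCons c p = [:c:] + poly_z * p" by (simp add: poly_z_def)
    then have "sphere_of (pCons c p) = sphere_of [:c:] + sphere_z * sphere_of p"
      by (simp only: sphere_of_hom sphere_z_def)
    then show ?case using pCons.IH by (simp only: add mult 2 z)
  qed
  obtain p where "a = sphere_of p" by (rule sphere_cases)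
  with 3 show ?thesis by simp
qed

lemmas partial_add = derivation_add[OF derivation_partial]
lemmas partial_mult = derivation_mult[OF derivation_partial]
lemmas partial_0 = derivation_0[OF derivation_partial]
lemmas partial_1 = derivation_1[OF derivation_partial]
lemmas partial_loc_const = derivation_const[OF derivation_partial]

lemma t_var_simps [simp]: "t_var (Suc 0) = sphere_x" "t_var 2 = sphere_y"
  by (simp_all add: t_var_def)

text \<open>The differential of an element of \<open>A\<close> is an \<open>A\<close>-combination of \<open>dx\<close>, \<open>dy\<close> and
  \<open>dz = -(x/z) dx - (y/z) dy\<close>.\<close>

lemma differential_expansion:
  fixes a :: "'k::field_char_0 sphere"
  obtains a1 a2 a3 where
    "partial (Suc 0) (to_loc a) = to_loc a1 - to_loc a3 * to_loc sphere_x * z_inv"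
    "partial 2 (to_loc a) = to_loc a2 - to_loc a3 * to_loc sphere_y * z_inv"
proof -
  have "\<exists>a1 a2 a3. partial (Suc 0) (to_loc a) = to_loc a1 - to_loc a3 * to_loc sphere_x * z_inv \<and>
    partial 2 (to_loc a) = to_loc a2 - to_loc a3 * to_loc sphere_y * z_inv"
  proof (induction a rule: sphere_induct)
    case (const c)
    show ?case
      by (intro exI[of _ 0]) (simp add: partial_loc_const flip: loc_const_def)
  next
    case x
    show ?case by (rule exI[of _ 1], rule exI[of _ 0], rule exI[of _ 0]) (simp add: partial_xy)
  next
    case y
    show ?case by (rule exI[of _ 0], rule exI[of _ 1], rule exI[of _ 0]) (simp add: partial_xy)
  next
    case z
    show ?case by (rule exI[of _ 0], rule exI[of _ 0], rule exI[of _ 1]) (simp add: partial_z)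
  next
    case (add a b)
    then obtain a1 a2 a3 b1 b2 b3 where
      "partial (Suc 0) (to_loc a) = to_loc a1 - to_loc a3 * to_loc sphere_x * z_inv"
      "partial 2 (to_loc a) = to_loc a2 - to_loc a3 * to_loc sphere_y * z_inv"
      "partial (Suc 0) (to_loc b) = to_loc b1 - to_loc b3 * to_loc sphere_x * z_inv"
      "partial 2 (to_loc b) = to_loc b2 - to_loc b3 * to_loc sphere_y * z_inv" by blast
    then show ?case
      by - (rule exI[of _ "a1 + b1"], rule exI[of _ "a2 + b2"], rule exI[of _ "a3 + b3"],
        simp add: partial_add algebra_simps)
  next
    case (mult a b)
    then obtain a1 a2 a3 b1 b2 b3 where ab:
      "partial (Suc 0) (to_loc a) = to_loc a1 - to_loc a3 * to_loc sphere_x * z_inv"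
      "partial 2 (to_loc a) = to_loc a2 - to_loc a3 * to_loc sphere_y * z_inv"
      "partial (Suc 0) (to_loc b) = to_loc b1 - to_loc b3 * to_loc sphere_x * z_inv"
      "partial 2 (to_loc b) = to_loc b2 - to_loc b3 * to_loc sphere_y * z_inv" by blast
    show ?case
      by (rule exI[of _ "a1 * b + a * b1"], rule exI[of _ "a2 * b + a * b2"],
          rule exI[of _ "a3 * b + a * b3"])
        (simp add: partial_mult ab, simp add: algebra_simps)
  qed
  with that show ?thesis by blast
qed

section \<open>Computing with powers of z\<close>

lemma z_cancel [simp]: "to_loc sphere_z * (z_inv * a) = a" "z_inv * (to_loc sphere_z * a) = a"
  by (simp_all flip: mult.assoc)

lemma z_cancel_left [simp]:
  "to_loc sphere_z * (b * (z_inv * a)) = b * a" "z_inv * (b * (to_loc sphere_z * a)) = b * a"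
  by (simp_all add: mult.left_commute[of _ b])

lemma of_int_in_loc:
  "loc_const (of_nat n :: 'k::field) = of_nat n"
  "loc_const (of_int i :: 'k::field) = of_int i"
  "to_loc (of_nat n :: 'k sphere) = of_nat n"
  "to_loc (of_int i :: 'k sphere) = of_int i"
proof -
  show 1: "loc_const (of_nat n :: 'k::field) = of_nat n" for n by (induction n) simp_all
  show 2: "to_loc (of_nat n :: 'k sphere) = of_nat n" for n by (induction n) simp_all
  show "loc_const (of_int i :: 'k::field) = of_int i" by (cases i rule: int_diff_cases) (simp add: 1)
  show "to_loc (of_int i :: 'k sphere) = of_int i" by (cases i rule: int_diff_cases) (simp add: 2)
qed

lemma z_pow_inverse: "z_pow e * z_pow (- e) = 1" "z_pow (- e) * z_pow e = 1"
  by (simp_all flip: z_pow_add) (simp_all add: z_pow_def)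

lemma z_pow_step: "z_pow (e + 1) = z_pow e * to_loc sphere_z" "z_pow (e - 1) = z_pow e * z_inv"
  using z_pow_add[of e 1] z_pow_add[of e "-1"] by (simp_all add: z_pow_def)

text \<open>Obtained by differentiating z * z^-1 = 1.\<close>

lemma partial_z_inv:
  "partial i z_inv = to_loc (t_var i) * z_inv * z_inv * (z_inv :: 'k::field_char_0 sphere_loc)"
proof -
  have "partial i (to_loc sphere_z * z_inv) = (0 :: 'k sphere_loc)"
    by (simp add: partial_1)
  then have "to_loc sphere_z * partial i z_inv = to_loc (t_var i) * z_inv * (z_inv :: 'k sphere_loc)"
    by (simp only: partial_mult partial_z) (simp add: eq_neg_iff_add_eq_0)
  then have "z_inv * (to_loc sphere_z * partial i z_inv) =
      z_inv * (to_loc (t_var i) * z_inv * (z_inv :: 'k sphere_loc))" by simp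
  then show ?thesis by (simp add: mult_ac)
qed

lemma partial_z_pow:
  "partial i (z_pow e :: 'k::field_char_0 sphere_loc) =
    - (of_int e * to_loc (t_var i) * z_inv * z_inv * z_pow e)"
proof (induction e rule: int_induct[of _ 0])
  case base
  show ?case by (simp add: z_pow_def partial_1)
next
  case (step1 e)
  show ?case
    by (simp add: z_pow_step partial_mult partial_z step1.IH) (simp add: algebra_simps)
next
  case (step2 e)
  show ?case
    by (simp add: z_pow_step partial_mult partial_z_inv step2.IH) (simp add: algebra_simps)
qed

section \<open>Rotations\<close>

text \<open>Since \<open>to_loc\<close> is injective, the laws of a derivation can be checked in the
  localization.\<close>

lemma Der_from_loc:
  assumes D: "derivation loc_const D" and A: "\<And>a. \<exists>b. D (to_loc a) = to_loc b"
  obtains \<eta> where "\<eta> \<in> Der" "\<And>a. to_loc (\<eta> a) = D (to_loc a)"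
proof -
  from A obtain \<eta> where \<eta>: "\<And>a. to_loc (\<eta> a) = D (to_loc a)" by metis
  have "derivation sphere_const \<eta>"
    unfolding derivation_def
    by (simp add: \<eta> derivation_add[OF D] derivation_mult[OF D]
        derivation_const[OF D, unfolded loc_const_def] flip: to_loc_eq_iff)
  with \<eta> that show ?thesis by (auto simp: Der_def)
qed

text \<open>The factor z clears the simple pole in \<open>differential_expansion\<close>. For i = 1
  the derivation sends x to z, z to -x and y to 0; for i = 2 the roles of x and y are
  exchanged.\<close>

lemma rotation_exists:
  assumes "i = Suc 0 \<or> i = 2"
  obtains \<eta> :: "'k::field_char_0 sphere \<Rightarrow> 'k sphere" where
    "\<eta> \<in> Der" "\<And>a. to_loc (\<eta> a) = to_loc sphere_z * partial i (to_loc a)"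
proof (rule Der_from_loc)
  show "derivation loc_const (\<lambda>g :: 'k sphere_loc. to_loc sphere_z * partial i g)"
    using derivation_lincomb[OF derivation_partial derivation_partial, of "to_loc sphere_z" i 0 i] by simp
  fix a :: "'k sphere"
  obtain a1 a2 a3 where da:
    "partial (Suc 0) (to_loc a) = to_loc a1 - to_loc a3 * to_loc sphere_x * z_inv"
    "partial 2 (to_loc a) = to_loc a2 - to_loc a3 * to_loc sphere_y * z_inv"
    by (rule differential_expansion)
  have "to_loc sphere_z * partial i (to_loc a) =
    to_loc (if i = 2 then sphere_z * a2 - a3 * sphere_y else sphere_z * a1 - a3 * sphere_x)"
    using assms by (elim disjE) (simp_all add: da algebra_simps)
  then show "\<exists>b. to_loc sphere_z * partial i (to_loc a) = to_loc b" by blast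
qed (rule that)

section \<open>Bounded submodules force integrality\<close>

lemma sphere_const_diff: "sphere_const (c - d) = sphere_const c - sphere_const d"
  using sphere_const_hom(3)[of "c - d" d] by (simp add: algebra_simps)

lemma sphere_const_of_nat: "sphere_const (of_nat n) = of_nat n"
  by (induction n) simp_all

lemma dvd_sphere_const_mult_iff: "c \<noteq> 0 \<Longrightarrow> b dvd sphere_const c * a \<longleftrightarrow> b dvd a"
proof
  assume "c \<noteq> 0" "b dvd sphere_const c * a"
  then have "b dvd sphere_const (inverse c) * (sphere_const c * a)" by simp
  moreover have "sphere_const (inverse c) * (sphere_const c * a) = sphere_const (inverse c * c) * a"
    by (simp only: sphere_const_hom mult.assoc)
  ultimately show "b dvd a" using \<open>c \<noteq> 0\<close> by simp
qed simp

text \<open>Work modulo z. Eliminating \<open>a (Suc l)\<close> shows that y annihilates every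
  coefficient; then the first relation shows that x does too. As x^2 + y^2 + z^2 = 1, the
  coefficients themselves vanish.\<close>

lemma leading_coefficients_vanish:
  fixes a :: "nat \<Rightarrow> 'k::field_char_0 sphere" and \<beta> :: 'k
  assumes \<beta>: "\<beta> \<notin> \<int>"
    and 1: "\<And>l. l \<le> m \<Longrightarrow> sphere_z dvd
      sphere_x * sphere_const (\<beta> - of_nat l) * a l + of_nat l * sphere_y * a (l - 1)"
    and 2: "\<And>l. l \<le> m \<Longrightarrow> sphere_z dvd
      sphere_y * sphere_const (\<beta> - of_nat m + of_nat l) * a l +
      (of_nat m - of_nat l) * sphere_x * a (Suc l)"
    and l: "l \<le> m"
  shows "sphere_z dvd a l"
proof -
  have ne: "\<beta> - of_nat n \<noteq> 0" for n
    using \<beta> Ints_of_nat[of n] by auto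
  have y: "sphere_z dvd sphere_y * a l" if "l \<le> m" for l
  proof (cases "l = m")
    case True
    \<comment> \<open>At the end l = m the coefficient of \<open>a (Suc l)\<close> is 0, so the
      second relation suffices.\<close>
    have "sphere_const \<beta> * (sphere_y * a l) =
      sphere_y * sphere_const (\<beta> - of_nat m + of_nat l) * a l +
      (of_nat m - of_nat l) * sphere_x * a (Suc l)"
      using True by (simp add: mult_ac)
    then show ?thesis using 2[OF that] ne[of 0]
      by (metis dvd_sphere_const_mult_iff diff_zero of_nat_0)
  next
    case False
    with that have "Suc l \<le> m" by simp
    let ?u = "sphere_x * sphere_const (\<beta> - of_nat (Suc l)) * a (Suc l) +
      of_nat (Suc l) * sphere_y * a (Suc l - 1)"
    let ?v = "sphere_y * sphere_const (\<beta> - of_nat m + of_nat l) * a l +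
      (of_nat m - of_nat l) * sphere_x * a (Suc l)"
    \<comment> \<open>The second relation at l is combined with the first one at l + 1. The
      remaining coefficient (\<beta> - l - 1)(\<beta> - m + l) - (m - l)(l + 1) factors as
      \<beta>(\<beta> - m - 1), which is nonzero for non-integral \<beta>.\<close>
    have "sphere_const ((\<beta> - of_nat 0) * (\<beta> - of_nat (Suc m))) * (sphere_y * a l) =
      sphere_const (\<beta> - of_nat (Suc l)) * ?v - (of_nat m - of_nat l) * ?u"
      by (simp add: sphere_const_diff sphere_const_of_nat algebra_simps)
    moreover have "sphere_z dvd sphere_const (\<beta> - of_nat (Suc l)) * ?v - (of_nat m - of_nat l) * ?u"
      using 1[OF \<open>Suc l \<le> m\<close>] 2[OF that] by (intro dvd_diff dvd_mult)
    ultimately show ?thesis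
      using ne[of 0] ne[of "Suc m"] by (metis dvd_sphere_const_mult_iff no_zero_divisors)
  qed
  have x: "sphere_z dvd sphere_x * a l"
  proof -
    have "sphere_z dvd of_nat l * sphere_y * a (l - 1)"
      using y[of "l - 1"] l by (auto simp: mult.assoc)
    with 1[OF l] have "sphere_z dvd sphere_const (\<beta> - of_nat l) * (sphere_x * a l)"
      by (simp add: dvd_add_left_iff mult_ac)
    then show ?thesis using ne by (simp add: dvd_sphere_const_mult_iff)
  qed
  have "a l = (sphere_x ^ 2 + sphere_y ^ 2 + sphere_z ^ 2) * a l" by (simp add: sphere_equation)
  also have "\<dots> = sphere_x * (sphere_x * a l) + sphere_y * (sphere_y * a l) +
      sphere_z * (sphere_z * a l)"
    by (simp add: algebra_simps power2_eq_square)
  finally show ?thesis using x y[OF l] by (metis dvd_add dvd_mult dvd_triv_left)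
qed

text \<open>Cancelling z^d leaves u/z in A. This turns the condition that a rotation does not lower
  the degree into a divisibility by z.\<close>

lemma z_dvd_if_regular:
  assumes "z_pow d * to_loc b = z_pow d * to_loc e - z_pow d * z_inv * to_loc u"
  shows "sphere_z dvd u"
proof -
  have "to_loc u = z_pow (- d) * z_pow d * (z_inv * to_loc sphere_z) * to_loc u"
    by (simp add: z_pow_inverse)
  also have "\<dots> = z_pow (- d) * to_loc sphere_z * (z_pow d * z_inv * to_loc u)"
    by (simp only: mult_ac)
  also have "z_pow d * z_inv * to_loc u = z_pow d * to_loc (e - b)"
    using assms by (simp add: algebra_simps)
  also have "z_pow (- d) * to_loc sphere_z * (z_pow d * to_loc (e - b)) =
      (z_pow (- d) * z_pow d) * to_loc (sphere_z * (e - b))"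
    by (simp only: mult_ac to_loc_hom)
  finally have "to_loc u = to_loc (sphere_z * (e - b))" by (simp add: z_pow_inverse)
  then have "u = sphere_z * (e - b)" by (simp only: to_loc_eq_iff)
  then show ?thesis by simp
qed

text \<open>Rotations lower the degree unless the leading term satisfies the hypotheses of
  \<open>leading_coefficients_vanish\<close>, with \<open>\<beta> = d + (\<alpha> + m) / 2\<close>.\<close>

lemma no_bounded_AV_submodule:
  fixes \<alpha> :: "'k::field_char_0"
  assumes \<alpha>: "(of_nat m - \<alpha>) / 2 \<notin> \<int>"
  shows "\<not> bounded_AV_submodule m \<alpha> M"
proof
  assume "bounded_AV_submodule m \<alpha> M"
  then have M: "AV_submodule m \<alpha> M" "M \<noteq> {0}" "bdd_below (z_degree m ` (M - {0}))"
    by (simp_all add: bounded_AV_submodule_def)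
  have supp: "w \<in> supp m" if "w \<in> M" for w using that M(1) by (auto simp: AV_submodule_def)
  have "0 \<in> M" using M(1) by (simp add: AV_submodule_def)
  with M(2) have "z_degree m ` (M - {0}) \<noteq> {}" by blast
  then obtain w0 where "w0 \<in> M - {0}" by blast
  from M(3) obtain K where K: "\<And>w. w \<in> M - {0} \<Longrightarrow> K \<le> z_degree m w"
    by (auto simp: bdd_below_def)
  \<comment> \<open>All degrees are at least K, so subtracting K gives natural numbers and a minimum
    is attained.\<close>
  obtain w where w: "w \<in> M - {0}"
    and min: "\<And>w'. w' \<in> M - {0} \<Longrightarrow> nat (z_degree m w - K) \<le> nat (z_degree m w' - K)"
    using ex_has_least_nat[of "\<lambda>w. w \<in> M - {0}", OF \<open>w0 \<in> M - {0}\<close>, of "\<lambda>w. nat (z_degree m w - K)"]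
    by blast
  define d where "d = z_degree m w"
  have "d \<le> z_degree m w'" if "w' \<in> M - {0}" for w'
    using min[OF that] K[OF w] K[OF that] by (simp add: d_def)
  then have filtration: "w' \<in> z_filtration m d" if "w' \<in> M" for w'
    using that z_degree_iff[of w' m d] supp[OF that]
    by (cases "w' = 0") (auto simp: z_filtration_def supp_def intro: exI[of _ 0])
  have not_filtration: "w \<notin> z_filtration m (d + 1)"
    using w z_degree_iff[of w m "d + 1"] supp[of w] by (simp add: d_def)
  from w filtration[of w] obtain a where a: "\<And>l. w l = z_pow d * to_loc (a l)"
    unfolding z_filtration_def by auto metis
  \<comment> \<open>On \<open>v_l\<close> the eigenvalues of E_11 and E_22, increased by the
    exponent d that comes from differentiating z^d, are \<beta> - l and \<beta> - m + l.\<close>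
  define \<beta> where "\<beta> = of_int d + (\<alpha> + of_nat m) / 2"
  have "\<beta> \<notin> \<int>"
  proof
    assume "\<beta> \<in> \<int>"
    then have "of_int d + of_nat m - \<beta> \<in> \<int>" by simp
    moreover have "of_int d + of_nat m - \<beta> = (of_nat m - \<alpha>) / 2" by (simp add: \<beta>_def field_simps)
    ultimately show False using \<alpha> by simp
  qed
  have dw: "partial i (w l) = - (of_int d * to_loc (t_var i) * z_inv * z_inv * z_pow d * to_loc (a l)) +
      z_pow d * partial i (to_loc (a l))" for i l
    by (simp add: a partial_mult partial_z_pow)
  have V: "\<exists>b. V_act m \<alpha> \<eta> w l = z_pow d * to_loc b" if "\<eta> \<in> Der" for \<eta> l
  proof -
    have "V_act m \<alpha> \<eta> w \<in> M" using that w M(1) by (simp add: AV_submodule_def)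
    from filtration[OF this] show ?thesis by (simp add: z_filtration_def)
  qed
  have "sphere_z dvd a l" if l: "l \<le> m" for l
  proof (rule leading_coefficients_vanish[OF \<open>\<beta> \<notin> \<int>\<close> _ _ l])
    fix l assume l: "l \<le> m"
    have ws: "w \<in> supp m" using w supp by simp
    obtain \<eta> :: "'k sphere \<Rightarrow> 'k sphere" where \<eta>: "\<eta> \<in> Der" "\<And>a. to_loc (\<eta> a) = to_loc sphere_z * partial (Suc 0) (to_loc a)"
      using rotation_exists[of "Suc 0"] by blast
    obtain b where b: "V_act m \<alpha> \<eta> w l = z_pow d * to_loc b" using V[OF \<eta>(1)] by blast
    have e: "\<beta> - of_nat l = of_int d + (\<alpha> + of_nat m - 2 * of_nat l) / 2"
      by (simp add: \<beta>_def field_simps)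
    \<comment> \<open>Here f_1 = z and f_2 = 0, so only E_11 and E_21 act, with coefficients -x/z
      and -y/z.\<close>
    show "sphere_z dvd sphere_x * sphere_const (\<beta> - of_nat l) * a l + of_nat l * sphere_y * a (l - 1)"
    proof (rule z_dvd_if_regular)
      show "z_pow d * to_loc b = z_pow d * to_loc (\<eta> (a l)) - z_pow d * z_inv *
        to_loc (sphere_x * sphere_const (\<beta> - of_nat l) * a l + of_nat l * sphere_y * a (l - 1))"
        unfolding b[symmetric] V_act_apply[OF ws] e
        by (simp add: \<eta>(2) partial_xy partial_0 partial_z E_loc_apply[OF ws l] dw
            of_int_in_loc flip: loc_const_def) (simp add: a algebra_simps)
    qed
  next
    fix l assume l: "l \<le> m"
    have ws: "w \<in> supp m" using w supp by simp
    obtain \<eta> :: "'k sphere \<Rightarrow> 'k sphere" where \<eta>: "\<eta> \<in> Der" "\<And>a. to_loc (\<eta> a) = to_loc sphere_z * partial 2 (to_loc a)"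
      using rotation_exists[of 2] by blast
    obtain b where b: "V_act m \<alpha> \<eta> w l = z_pow d * to_loc b" using V[OF \<eta>(1)] by blast
    have e: "\<beta> - of_nat m + of_nat l = of_int d + (\<alpha> - of_nat m + 2 * of_nat l) / 2"
      by (simp add: \<beta>_def field_simps)
    \<comment> \<open>Here f_1 = 0 and f_2 = z, so only E_12 and E_22 act, with coefficients -x/z
      and -y/z.\<close>
    show "sphere_z dvd sphere_y * sphere_const (\<beta> - of_nat m + of_nat l) * a l +
      (of_nat m - of_nat l) * sphere_x * a (Suc l)"
    proof (rule z_dvd_if_regular)
      show "z_pow d * to_loc b = z_pow d * to_loc (\<eta> (a l)) - z_pow d * z_inv *
        to_loc (sphere_y * sphere_const (\<beta> - of_nat m + of_nat l) * a l +
          (of_nat m - of_nat l) * sphere_x * a (Suc l))"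
        unfolding b[symmetric] V_act_apply[OF ws] e
        by (simp add: \<eta>(2) partial_xy partial_0 partial_z E_loc_apply[OF ws l] dw
            of_int_in_loc flip: loc_const_def) (simp add: a algebra_simps)
    qed
  qed
  note z_dvd = this
  \<comment> \<open>Leading coefficients divisible by z would raise the degree of w above d.\<close>
  have "\<exists>b. w l = z_pow (d + 1) * to_loc b" for l
  proof (cases "l \<le> m")
    case True
    then obtain b where "a l = sphere_z * b" using z_dvd by blast
    then show ?thesis by (auto simp: a z_pow_step mult.assoc)
  next
    case False
    then have "w l = 0" using w supp[of w] by (simp add: supp_def)
    then show ?thesis by (intro exI[of _ 0]) simp
  qed
  with w supp not_filtration show False by (auto simp: z_filtration_def)
qed

section \<open>Regular symmetric differentials\<close>

text \<open>A homogeneous form of degree \<open>n\<close> in \<open>dx\<close> and \<open>dy\<close> is encoded by its coefficients, \<open>p l\<close>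
  being that of \<open>dx\<^sup>n\<^sup>-\<^sup>l dy\<^sup>l\<close>. Then \<open>shift\<close> is multiplication by \<open>dy\<close> and \<open>dmul g\<close> is
  multiplication by \<open>dg\<close>.\<close>

definition shift :: "(nat \<Rightarrow> 'r::zero) \<Rightarrow> nat \<Rightarrow> 'r" where
  "shift p l = (if l = 0 then 0 else p (l - 1))"

definition dmul :: "'k::field sphere_loc \<Rightarrow> (nat \<Rightarrow> 'k sphere_loc) \<Rightarrow> nat \<Rightarrow> 'k sphere_loc" where
  "dmul g p = (\<lambda>l. partial (Suc 0) g * p l + partial 2 g * shift p l)"

text \<open>This is the A-span of the products of n factors among dx, dy, dz, the image of the n-th
  symmetric power of the Kaehler differentials of A.\<close>

fun forms :: "nat \<Rightarrow> (nat \<Rightarrow> 'k::field sphere_loc) set" where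
  "forms 0 = {(\<lambda>l. if l = 0 then to_loc a else 0) |a. True}"
| "forms (Suc n) = {dmul (to_loc sphere_x) p + dmul (to_loc sphere_y) q + dmul (to_loc sphere_z) r
    |p q r. p \<in> forms n \<and> q \<in> forms n \<and> r \<in> forms n}"

text \<open>\<open>lie n f\<close> is the Lie derivative along \<open>f\<^sub>1 \<partial>/\<partial>x + f\<^sub>2 \<partial>/\<partial>y\<close> on forms of degree \<open>n\<close>.\<close>

definition lie ::
  "nat \<Rightarrow> (nat \<Rightarrow> 'k::field sphere_loc) \<Rightarrow> (nat \<Rightarrow> 'k sphere_loc) \<Rightarrow> nat \<Rightarrow> 'k sphere_loc" where
  "lie n f p = (\<lambda>l. f 1 * partial (Suc 0) (p l) + f 2 * partial 2 (p l) +
    partial (Suc 0) (f 1) * (of_nat n - of_nat l) * p l +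
    partial (Suc 0) (f 2) * of_nat (Suc l) * p (Suc l) +
    partial 2 (f 1) * (of_nat (Suc n) - of_nat l) * shift p l +
    partial 2 (f 2) * of_nat l * p l)"

lemma shift_linear:
  "shift (p + q) = shift p + shift q" "shift (\<lambda>l. c * p l) = (\<lambda>l. c * shift p l)"
  for c :: "'r::comm_ring_1"
  by (simp_all add: shift_def fun_eq_iff)

lemma dmul_linear:
  "dmul g (p + q) = dmul g p + dmul g q" "dmul g (\<lambda>l. c * p l) = (\<lambda>l. c * dmul g p l)"
  by (simp_all add: dmul_def shift_linear fun_eq_iff algebra_simps)

lemma lie_add: "lie n f (p + q) = lie n f p + lie n f q"
  for f :: "nat \<Rightarrow> 'k::field_char_0 sphere_loc"
  by (simp add: lie_def shift_linear partial_add fun_eq_iff algebra_simps)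

lemma lie_mult:
  "lie n f (\<lambda>l. g * p l) = (\<lambda>l. (f 1 * partial (Suc 0) g + f 2 * partial 2 g) * p l + g * lie n f p l)"
  for f :: "nat \<Rightarrow> 'k::field_char_0 sphere_loc"
  by (simp add: lie_def shift_linear partial_mult fun_eq_iff algebra_simps)

text \<open>Multiplication by dx keeps the coefficient sequence and only raises the degree, so this
  is the Leibniz rule for dx, whose Lie derivative is df_1.\<close>

lemma lie_Suc: "lie (Suc n) f p = (\<lambda>l. lie n f p l + dmul (f 1) p l)"
  by (simp add: lie_def dmul_def fun_eq_iff algebra_simps)

text \<open>The Leibniz rule for dy, whose Lie derivative is df_2.\<close>

lemma lie_shift: "lie (Suc n) f (shift p) = (\<lambda>l. shift (lie n f p) l + dmul (f 2) p l)"
  for f :: "nat \<Rightarrow> 'k::field_char_0 sphere_loc"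
proof
  fix l
  show "lie (Suc n) f (shift p) l = shift (lie n f p) l + dmul (f 2) p l"
    by (cases l) (simp_all add: lie_def dmul_def shift_def partial_0 algebra_simps)
qed

text \<open>The Lie derivative commutes with the exterior derivative and satisfies the Leibniz rule.\<close>

lemma lie_dmul:
  fixes f :: "nat \<Rightarrow> 'k::field_char_0 sphere_loc"
  shows "lie (Suc n) f (dmul g p) =
    dmul (f 1 * partial (Suc 0) g + f 2 * partial 2 g) p + dmul g (lie n f p)"
proof -
  \<comment> \<open>The parts of dg along dx and dy are treated by \<open>lie_Suc\<close> and
    \<open>lie_shift\<close>; recombining them uses the equality of mixed partial
    derivatives.\<close>
  have "dmul g p = (\<lambda>l. partial (Suc 0) g * p l) + (\<lambda>l. partial 2 g * shift p l)"
    by (simp add: dmul_def fun_eq_iff)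
  then show ?thesis
    by (simp only: lie_add lie_mult lie_shift)
      (simp add: lie_Suc dmul_def fun_eq_iff partial_add partial_mult partial_commute algebra_simps)
qed

section \<open>Closure properties and poles of regular forms\<close>

lemma forms_scale: "p \<in> forms n \<Longrightarrow> (\<lambda>l. to_loc a * p l) \<in> forms n"
proof (induction n arbitrary: p)
  case 0
  then obtain b where "p = (\<lambda>l. if l = 0 then to_loc b else 0)" by auto
  then have "(\<lambda>l. to_loc a * p l) = (\<lambda>l. if l = 0 then to_loc (a * b) else 0)"
    by (simp add: fun_eq_iff)
  then show ?case unfolding forms.simps by blast
next
  case (Suc n)
  then obtain p1 p2 p3 where p: "p = dmul (to_loc sphere_x) p1 + dmul (to_loc sphere_y) p2 +
      dmul (to_loc sphere_z) p3" "p1 \<in> forms n" "p2 \<in> forms n" "p3 \<in> forms n" by auto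
  have "(\<lambda>l. to_loc a * p l) = dmul (to_loc sphere_x) (\<lambda>l. to_loc a * p1 l) +
      dmul (to_loc sphere_y) (\<lambda>l. to_loc a * p2 l) + dmul (to_loc sphere_z) (\<lambda>l. to_loc a * p3 l)"
    by (simp add: dmul_linear p(1) fun_eq_iff algebra_simps)
  with p(2-) Suc.IH show ?case unfolding forms.simps by blast
qed

lemma forms_add: "p \<in> forms n \<Longrightarrow> q \<in> forms n \<Longrightarrow> p + q \<in> forms n"
proof (induction n arbitrary: p q)
  case 0
  then obtain a b where "p = (\<lambda>l. if l = 0 then to_loc a else 0)"
    "q = (\<lambda>l. if l = 0 then to_loc b else 0)" by auto
  then have "p + q = (\<lambda>l. if l = 0 then to_loc (a + b) else 0)"
    by (simp add: fun_eq_iff)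
  then show ?case unfolding forms.simps by blast
next
  case (Suc n)
  then obtain p1 p2 p3 q1 q2 q3 where p: "p = dmul (to_loc sphere_x) p1 + dmul (to_loc sphere_y) p2 +
      dmul (to_loc sphere_z) p3" "p1 \<in> forms n" "p2 \<in> forms n" "p3 \<in> forms n"
    and q: "q = dmul (to_loc sphere_x) q1 + dmul (to_loc sphere_y) q2 +
      dmul (to_loc sphere_z) q3" "q1 \<in> forms n" "q2 \<in> forms n" "q3 \<in> forms n" by auto
  have "p + q = dmul (to_loc sphere_x) (p1 + q1) +
      dmul (to_loc sphere_y) (p2 + q2) + dmul (to_loc sphere_z) (p3 + q3)"
    by (simp only: dmul_linear p(1) q(1) add_ac)
  with p(2-) q(2-) Suc.IH show ?case unfolding forms.simps by blast
qed

lemma forms_0: "0 \<in> forms n"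
proof (induction n)
  case 0
  have "0 = (\<lambda>l. if l = 0 then to_loc 0 else (0 :: 'a sphere_loc))" by (simp add: fun_eq_iff)
  then show ?case unfolding forms.simps by blast
next
  case (Suc n)
  have "0 = dmul (to_loc sphere_x) 0 + dmul (to_loc sphere_y) 0 + dmul (to_loc sphere_z :: 'a sphere_loc) 0"
    by (simp add: dmul_def shift_def fun_eq_iff)
  with Suc show ?case unfolding forms.simps by blast
qed

text \<open>By \<open>differential_expansion\<close>, da = a1 dx + a2 dy + a3 dz with coefficients
  in A, which \<open>forms_scale\<close> absorbs.\<close>

lemma dmul_forms:
  fixes a :: "'k::field_char_0 sphere"
  assumes "p \<in> forms n"
  shows "dmul (to_loc a) p \<in> forms (Suc n)"
proof -
  obtain a1 a2 a3 where a:
    "partial (Suc 0) (to_loc a) = to_loc a1 - to_loc a3 * to_loc sphere_x * z_inv"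
    "partial 2 (to_loc a) = to_loc a2 - to_loc a3 * to_loc sphere_y * z_inv"
    by (rule differential_expansion)
  have "dmul (to_loc a) p = dmul (to_loc sphere_x) (\<lambda>l. to_loc a1 * p l) +
      dmul (to_loc sphere_y) (\<lambda>l. to_loc a2 * p l) + dmul (to_loc sphere_z) (\<lambda>l. to_loc a3 * p l)"
    by (simp add: dmul_def shift_linear a partial_xy partial_z fun_eq_iff algebra_simps)
  with forms_scale[OF assms] show ?thesis unfolding forms.simps by blast
qed

lemma Der_expand:
  fixes \<eta> :: "'k::field_char_0 sphere \<Rightarrow> 'k sphere"
  assumes "\<eta> \<in> Der"
  shows "to_loc (\<eta> a) = to_loc (\<eta> sphere_x) * partial (Suc 0) (to_loc a) +
    to_loc (\<eta> sphere_y) * partial 2 (to_loc a)"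
  using Der_conv_partial[OF assms, of a] by simp

text \<open>By \<open>lie_dmul\<close>, the Lie derivative of da p is d(\<eta> a) p plus da times
  the Lie derivative of p, and \<eta> a is again in A.\<close>

lemma lie_forms:
  fixes \<eta> :: "'k::field_char_0 sphere \<Rightarrow> 'k sphere"
  assumes \<eta>: "\<eta> \<in> Der"
  shows "p \<in> forms n \<Longrightarrow> lie n (\<lambda>i. to_loc (\<eta> (t_var i))) p \<in> forms n"
proof (induction n arbitrary: p)
  case 0
  then obtain a where p: "p = (\<lambda>l. if l = 0 then to_loc a else 0)" by auto
  have "lie 0 (\<lambda>i. to_loc (\<eta> (t_var i))) p l = (if l = 0 then to_loc (\<eta> a) else 0)" for l
  proof -
    \<comment> \<open>At l = 1 the shifted sequence picks up \<open>p 0\<close>, but its factor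
      \<open>of_nat (Suc 0) - of_nat 1\<close> is 0.\<close>
    consider "l = 0" | "l = 1" | "l > 1" by linarith
    then show ?thesis
      by cases (simp_all add: p lie_def shift_def partial_0 Der_expand[OF \<eta>, of a])
  qed
  then show ?case unfolding forms.simps by blast
next
  case (Suc n)
  have *: "lie (Suc n) (\<lambda>i. to_loc (\<eta> (t_var i))) (dmul (to_loc a) p) \<in> forms (Suc n)"
    if "p \<in> forms n" for a p
  proof -
    have "lie (Suc n) (\<lambda>i. to_loc (\<eta> (t_var i))) (dmul (to_loc a) p) =
        dmul (to_loc (\<eta> a)) p + dmul (to_loc a) (lie n (\<lambda>i. to_loc (\<eta> (t_var i))) p)"
      by (simp add: lie_dmul Der_expand[OF \<eta>, of a])
    then show ?thesis using that Suc.IH by (simp only: forms_add dmul_forms)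
  qed
  from Suc.prems obtain p1 p2 p3 where p: "p = dmul (to_loc sphere_x) p1 + dmul (to_loc sphere_y) p2 +
      dmul (to_loc sphere_z) p3" "p1 \<in> forms n" "p2 \<in> forms n" "p3 \<in> forms n" by auto
  show ?case unfolding p(1) lie_add using p(2-) by (intro forms_add *)
qed

text \<open>Among the three differentials only dz has a pole, and it is simple, so each factor adds
  at most one to the pole order.\<close>

lemma forms_pole_order:
  fixes p :: "nat \<Rightarrow> 'k::field_char_0 sphere_loc"
  shows "p \<in> forms n \<Longrightarrow> \<exists>a. p l = z_inv ^ n * to_loc a"
proof (induction n arbitrary: p l)
  case 0
  then obtain a where "p = (\<lambda>l. if l = 0 then to_loc a else 0)" by auto
  then have "p l = z_inv ^ 0 * to_loc (if l = 0 then a else 0)" by simp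
  then show ?case by blast
next
  case (Suc n)
  then obtain p1 p2 p3 where p: "p = dmul (to_loc sphere_x) p1 + dmul (to_loc sphere_y) p2 +
      dmul (to_loc sphere_z) p3" "p1 \<in> forms n" "p2 \<in> forms n" "p3 \<in> forms n" by auto
  have *: "\<exists>a. \<forall>l. q l = z_inv ^ n * to_loc (a l) \<and> shift q l = z_inv ^ n * to_loc (shift a l)"
    if q: "q \<in> forms n" for q :: "nat \<Rightarrow> 'k sphere_loc"
  proof -
    from Suc.IH[OF q] obtain a where "\<And>l. q l = z_inv ^ n * to_loc (a l)" by metis
    then show ?thesis by (intro exI[of _ a]) (simp add: shift_def)
  qed
  from *[OF p(2)] *[OF p(3)] *[OF p(4)] obtain a1 a2 a3 where a:
    "\<And>l. p1 l = z_inv ^ n * to_loc (a1 l)" "\<And>l. shift p2 l = z_inv ^ n * to_loc (shift a2 l)"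
    "\<And>l. p3 l = z_inv ^ n * to_loc (a3 l)" "\<And>l. shift p3 l = z_inv ^ n * to_loc (shift a3 l)"
    by blast
  have "p l = z_inv ^ Suc n * to_loc (sphere_z * (a1 l + shift a2 l) - sphere_x * a3 l - sphere_y * shift a3 l)"
    by (simp add: p(1) dmul_def partial_xy partial_z a) (simp add: algebra_simps)
  then show ?case by blast
qed

text \<open>These are the coefficients of (-dz)^n = z^-n (x dx + y dy)^n; the induction step is
  Pascal's rule.\<close>

lemma binomial_forms:
  "(\<lambda>l. of_nat (n choose l) * z_inv ^ n * to_loc sphere_x ^ (n - l) * to_loc sphere_y ^ l)
    \<in> (forms n :: (nat \<Rightarrow> 'k::field_char_0 sphere_loc) set)"
proof (induction n)
  case 0
  have "(\<lambda>l. of_nat (0 choose l) * z_inv ^ 0 * to_loc sphere_x ^ (0 - l) * to_loc sphere_y ^ l) =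
    (\<lambda>l. if l = 0 then to_loc 1 else (0 :: 'k sphere_loc))"
    by (rule ext) (simp add: binomial_eq_0)
  then show ?case unfolding forms.simps by blast
next
  case (Suc n)
  let ?b = "\<lambda>n l. of_nat (n choose l) * z_inv ^ n * to_loc sphere_x ^ (n - l) * to_loc sphere_y ^ l
    :: 'k sphere_loc"
  have "?b (Suc n) l = dmul (to_loc sphere_z) (\<lambda>l. to_loc (- 1) * ?b n l) l" for l
  proof -
    \<comment> \<open>Beyond l = n the truncated exponents no longer match, but the binomial
      coefficient is 0.\<close>
    have x: "to_loc sphere_x * (of_nat (n choose l) * to_loc sphere_x ^ (n - l)) =
      of_nat (n choose l) * (to_loc sphere_x ^ (Suc n - l) :: 'k sphere_loc)"
      by (cases "l \<le> n") (simp_all add: Suc_diff_le binomial_eq_0)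
    show ?thesis
    proof (cases l)
      case 0
      then show ?thesis by (simp add: dmul_def shift_def partial_z)
    next
      case (Suc l')
      have "dmul (to_loc sphere_z) (\<lambda>l. to_loc (- 1) * ?b n l) l = 
          z_inv ^ Suc n * to_loc sphere_y ^ l * 
          (to_loc sphere_x * (of_nat (n choose l) * to_loc sphere_x ^ (n - l))) +
          z_inv ^ Suc n * to_loc sphere_y ^ l * (of_nat (n choose l') * to_loc sphere_x ^ (n - l'))"
        by (simp add: dmul_def shift_def partial_z Suc algebra_simps)
      then show ?thesis unfolding x by (simp add: Suc algebra_simps)
    qed
  qed
  then have "?b (Suc n) = dmul (to_loc sphere_z) (\<lambda>l. to_loc (- 1) * ?b n l)" by (rule ext)
  also have "\<dots> \<in> forms (Suc n)" by (rule dmul_forms[OF forms_scale[OF Suc]])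
  finally show ?case .
qed

text \<open>This is the divergence of \<open>\<eta>\<close> with respect to the area form \<open>z\<^sup>-\<^sup>1 dx \<and> dy\<close>. Differentiating
  \<open>x \<eta>(x) + y \<eta>(y) + z \<eta>(z) = 0\<close> shows that its polar part is regular.\<close>

lemma divergence_regular:
  fixes \<eta> :: "'k::field_char_0 sphere \<Rightarrow> 'k sphere"
  assumes \<eta>: "\<eta> \<in> Der"
  obtains e where "partial (Suc 0) (to_loc (\<eta> sphere_x)) + partial 2 (to_loc (\<eta> sphere_y)) -
    z_inv * to_loc (\<eta> sphere_z) = to_loc e"
proof -
  obtain a1 a2 a3 where a:
    "partial (Suc 0) (to_loc (\<eta> sphere_x)) = to_loc a1 - to_loc a3 * to_loc sphere_x * z_inv"
    "partial 2 (to_loc (\<eta> sphere_x)) = to_loc a2 - to_loc a3 * to_loc sphere_y * z_inv"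
    by (rule differential_expansion)
  obtain b1 b2 b3 where b:
    "partial (Suc 0) (to_loc (\<eta> sphere_y)) = to_loc b1 - to_loc b3 * to_loc sphere_x * z_inv"
    "partial 2 (to_loc (\<eta> sphere_y)) = to_loc b2 - to_loc b3 * to_loc sphere_y * z_inv"
    by (rule differential_expansion)
  obtain c1 c2 c3 where c:
    "partial (Suc 0) (to_loc (\<eta> sphere_z)) = to_loc c1 - to_loc c3 * to_loc sphere_x * z_inv"
    "partial 2 (to_loc (\<eta> sphere_z)) = to_loc c2 - to_loc c3 * to_loc sphere_y * z_inv"
    by (rule differential_expansion)
  \<comment> \<open>These are the coefficients of dx, dy, dz in the differential of x \<eta>(x) + y
    \<eta>(y) + z \<eta>(z).\<close>
  define g1 where "g1 = \<eta> sphere_x + sphere_x * a1 + sphere_y * b1 + sphere_z * c1"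
  define g2 where "g2 = \<eta> sphere_y + sphere_x * a2 + sphere_y * b2 + sphere_z * c2"
  define g3 where "g3 = \<eta> sphere_z + sphere_x * a3 + sphere_y * b3 + sphere_z * c3"
  have tangent: "to_loc sphere_x * to_loc (\<eta> sphere_x) + to_loc sphere_y * to_loc (\<eta> sphere_y) +
      to_loc sphere_z * to_loc (\<eta> sphere_z) = 0"
    by (simp add: Der_expand[OF \<eta>, of sphere_z] partial_z algebra_simps)
  have "to_loc g1 - to_loc sphere_x * z_inv * to_loc g3 = 0"
    using arg_cong[OF tangent, of "partial (Suc 0)"]
    unfolding partial_add partial_mult partial_xy partial_z partial_0 t_var_simps a b c
    by (simp add: g1_def g3_def) (simp add: algebra_simps)
  then have g1: "to_loc g1 = to_loc sphere_x * z_inv * to_loc g3" by simp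
  have "to_loc g2 - to_loc sphere_y * z_inv * to_loc g3 = 0"
    using arg_cong[OF tangent, of "partial 2"]
    unfolding partial_add partial_mult partial_xy partial_z partial_0 t_var_simps a b c
    by (simp add: g2_def g3_def) (simp add: algebra_simps)
  then have g2: "to_loc g2 = to_loc sphere_y * z_inv * to_loc g3" by simp
  \<comment> \<open>The vector (g1, g2, g3) is g3/z times (x, y, z), so its product with (x, y, z)
    recovers g3/z and shows that it lies in A.\<close>
  have "z_inv * to_loc g3 = z_inv * to_loc ((sphere_x ^ 2 + sphere_y ^ 2 + sphere_z ^ 2) * g3)"
    by (simp only: sphere_equation mult_1_left)
  also have "\<dots> = to_loc (sphere_x * g1 + sphere_y * g2 + sphere_z * g3)"
    by (simp add: g1 g2 power2_eq_square algebra_simps)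
  finally have "z_inv * to_loc g3 = to_loc (sphere_x * g1 + sphere_y * g2 + sphere_z * g3)" .
  moreover have "partial (Suc 0) (to_loc (\<eta> sphere_x)) + partial 2 (to_loc (\<eta> sphere_y)) -
      z_inv * to_loc (\<eta> sphere_z) = to_loc (a1 + b2 + c3) - z_inv * to_loc g3"
    unfolding a b g3_def by (simp add: algebra_simps)
  ultimately show ?thesis using that[of "a1 + b2 + c3 - (sphere_x * g1 + sphere_y * g2 + sphere_z * g3)"]
    by (simp del: to_loc_hom)
qed

text \<open>\<open>w\<close> belongs to this set if and only if the form corresponding to it is a regular symmetric
  differential times the \<open>c\<close>-th power of \<open>z\<^sup>-\<^sup>1 dx \<and> dy\<close>.\<close>

definition regular_tensors :: "nat \<Rightarrow> int \<Rightarrow> (nat \<Rightarrow> 'k::field sphere_loc) set" where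
  "regular_tensors m c = {w \<in> supp m. \<exists>p\<in>forms m. \<forall>l. of_nat (m choose l) * w l = z_pow (- c) * p l}"

section \<open>The action on regular tensors and their boundedness\<close>

lemma regular_tensorsI:
  assumes "w \<in> supp m" "p \<in> forms m" "\<And>l. of_nat (m choose l) * w l = z_pow (- c) * p l"
  shows "w \<in> regular_tensors m c"
  using assms unfolding regular_tensors_def by blast

text \<open>The binomial weights turn w into the coefficients of a form, on which the action becomes
  the Lie derivative. The additional term is the contribution of (dx \<and> dy)^c.\<close>

lemma binomial_V_act:
  fixes \<alpha> :: "'k::field_char_0"
  assumes \<alpha>: "\<alpha> = of_nat m + 2 * of_int c" and w: "w \<in> supp m" and \<eta>: "\<eta> \<in> Der"
  defines "f \<equiv> \<lambda>i. to_loc (\<eta> (t_var i))"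
  shows "of_nat (m choose l) * V_act m \<alpha> \<eta> w l = lie m f (\<lambda>l. of_nat (m choose l) * w l) l +
    of_int c * (partial (Suc 0) (f 1) + partial 2 (f 2)) * (of_nat (m choose l) * w l)"
proof (cases "l \<le> m")
  case False
  \<comment> \<open>At l = m + 1 the shifted sequence still sees \<open>w m\<close>, with factor
    \<open>of_nat (Suc m) - of_nat l\<close> = 0.\<close>
  have "lie m f (\<lambda>l. of_nat (m choose l) * w l) l = 0"
    using False w by (cases "l = Suc m") (auto simp: lie_def shift_def supp_def partial_0)
  then show ?thesis using False by (simp add: binomial_eq_0)
next
  case True
  have c: "(\<alpha> + of_nat m - 2 * of_nat l) / 2 = of_int c + of_nat m - of_nat l"
    "(\<alpha> - of_nat m + 2 * of_nat l) / 2 = of_int c + of_nat l"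
    by (simp_all add: \<alpha> field_simps)
  define B where "B k = (of_nat (m choose k) :: 'k sphere_loc)" for k
  \<comment> \<open>This identity converts the coefficients of E_12 and E_21 into those of
    \<open>lie\<close>.\<close>
  have absorb: "B k * (of_nat m - of_nat k) = of_nat (Suc k) * B (Suc k)" if "k \<le> m" for k
  proof -
    have "(m - k) * (m choose k) = Suc k * (m choose Suc k)"
      unfolding binomial_absorb_comp binomial_absorption ..
    then have "of_nat ((m - k) * (m choose k)) = (of_nat (Suc k * (m choose Suc k)) :: 'k sphere_loc)"
      by (rule arg_cong)
    then show ?thesis using that
      by (simp only: B_def of_nat_diff of_nat_mult mult.commute)
  qed
  have E12: "B l * ((of_nat m - of_nat l) * w (Suc l)) = of_nat (Suc l) * (B (Suc l) * w (Suc l))"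
    using absorb[OF True] by (simp only: mult.assoc[symmetric])
  have E21: "B l * (of_nat l * w (l - 1)) = (of_nat (Suc m) - of_nat l) * shift (\<lambda>l. B l * w l) l"
  proof (cases l)
    case (Suc k)
    then have "of_nat (Suc k) * B (Suc k) = B k * (of_nat m - of_nat k)"
      using absorb[of k] True by simp
    then have "of_nat (Suc k) * B (Suc k) * w k = B k * (of_nat m - of_nat k) * w k" by simp
    then show ?thesis by (simp add: Suc shift_def mult_ac)
  qed (simp add: shift_def)
  have dB: "partial i (B l * w l) = B l * partial i (w l)" for i
    using partial_loc_const[of i "of_nat (m choose l) :: 'k"] by (simp add: partial_mult B_def of_int_in_loc)
  have "B l * V_act m \<alpha> \<eta> w l =
      f 1 * (B l * partial (Suc 0) (w l)) + f 2 * (B l * partial 2 (w l)) +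
      partial (Suc 0) (f 1) * (of_int c + of_nat m - of_nat l) * (B l * w l) +
      partial (Suc 0) (f 2) * (B l * ((of_nat m - of_nat l) * w (Suc l))) +
      partial 2 (f 1) * (B l * (of_nat l * w (l - 1))) +
      partial 2 (f 2) * (of_int c + of_nat l) * (B l * w l)"
    unfolding V_act_apply[OF w]
    by (simp add: E_loc_apply[OF w True] c of_int_in_loc f_def) (simp add: algebra_simps)
  then show ?thesis
    unfolding B_def[symmetric] E12 E21 dB[symmetric] by (simp add: lie_def algebra_simps)
qed

text \<open>Differentiating z^-c contributes -c \<eta>(z)/z, which completes c times the divergence
  in x and y to c times the regular function e. So a form p is sent to its Lie derivative plus c e
  p.\<close>

lemma regular_tensors_submodule:
  fixes \<alpha> :: "'k::field_char_0"
  assumes \<alpha>: "\<alpha> = of_nat m + 2 * of_int c"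
  shows "AV_submodule m \<alpha> (regular_tensors m c)"
  unfolding AV_submodule_def
proof (intro conjI ballI allI)
  show "regular_tensors m c \<subseteq> (supp m :: (nat \<Rightarrow> 'k sphere_loc) set)"
    by (auto simp: regular_tensors_def)
  show "0 \<in> (regular_tensors m c :: (nat \<Rightarrow> 'k sphere_loc) set)"
    using forms_0[of m] by (auto simp: regular_tensors_def supp_def intro: bexI[of _ 0])
next
  fix w w' :: "nat \<Rightarrow> 'k sphere_loc"
  assume w: "w \<in> regular_tensors m c" "w' \<in> regular_tensors m c"
  then obtain p p' where p: "p \<in> forms m" "\<And>l. of_nat (m choose l) * w l = z_pow (- c) * p l"
    "p' \<in> forms m" "\<And>l. of_nat (m choose l) * w' l = z_pow (- c) * p' l"
    unfolding regular_tensors_def by blast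
  then have "of_nat (m choose l) * (w + w') l = z_pow (- c) * (p + p') l" for l
    by (simp add: distrib_left)
  moreover have "w + w' \<in> supp m" using w by (simp add: regular_tensors_def supp_def)
  ultimately show "w + w' \<in> regular_tensors m c"
    using forms_add[OF p(1,3)] by (intro regular_tensorsI)
next
  fix w :: "nat \<Rightarrow> 'k sphere_loc" and a
  assume w: "w \<in> regular_tensors m c"
  then obtain p where p: "p \<in> forms m" "\<And>l. of_nat (m choose l) * w l = z_pow (- c) * p l"
    unfolding regular_tensors_def by blast
  have "of_nat (m choose l) * A_act a w l = z_pow (- c) * (to_loc a * p l)" for l
    by (simp add: A_act_def scale_def mult.left_commute[of _ "to_loc a"] p(2))
  moreover have "A_act a w \<in> supp m" using w by (simp add: regular_tensors_def A_act_supp)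
  ultimately show "A_act a w \<in> regular_tensors m c"
    using forms_scale[OF p(1)] by (intro regular_tensorsI)
next
  fix \<eta> :: "'k sphere \<Rightarrow> 'k sphere" and w :: "nat \<Rightarrow> 'k sphere_loc"
  assume \<eta>: "\<eta> \<in> Der" and w: "w \<in> regular_tensors m c"
  let ?f = "\<lambda>i. to_loc (\<eta> (t_var i))"
  obtain p where p: "p \<in> forms m" "\<And>l. of_nat (m choose l) * w l = z_pow (- c) * p l"
    using w unfolding regular_tensors_def by blast
  have supp: "w \<in> supp m" using w by (simp add: regular_tensors_def)
  obtain e where e: "partial (Suc 0) (to_loc (\<eta> sphere_x)) + partial 2 (to_loc (\<eta> sphere_y)) -
      z_inv * to_loc (\<eta> sphere_z) = to_loc e"
    by (rule divergence_regular[OF \<eta>])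
  have e': "partial (Suc 0) (?f 1) + partial 2 (?f 2) = to_loc e + z_inv * to_loc (\<eta> sphere_z)"
    unfolding e[symmetric] by simp
  have d: "?f 1 * partial (Suc 0) (z_pow (- c)) + ?f 2 * partial 2 (z_pow (- c)) =
      - (of_int c * z_inv * to_loc (\<eta> sphere_z) * z_pow (- c))"
    by (simp add: partial_z_pow partial_z Der_expand[OF \<eta>, of sphere_z] algebra_simps)
  have "of_nat (m choose l) * V_act m \<alpha> \<eta> w l =
      z_pow (- c) * (lie m ?f p + (\<lambda>l. to_loc (of_int c * e) * p l)) l" for l
    unfolding binomial_V_act[OF \<alpha> supp \<eta>] p(2) lie_mult d e'
    by (simp add: of_int_in_loc algebra_simps)
  moreover have "lie m ?f p + (\<lambda>l. to_loc (of_int c * e) * p l) \<in> forms m"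
    by (intro forms_add lie_forms[OF \<eta>] forms_scale p(1))
  ultimately show "V_act m \<alpha> \<eta> w \<in> regular_tensors m c"
    using V_act_supp by (intro regular_tensorsI)
qed

text \<open>The form has pole order at most m, the twist contributes z^-c, and the binomial
  coefficients are invertible in characteristic zero.\<close>

lemma regular_tensors_filtration:
  "regular_tensors m c \<subseteq> (z_filtration m (- c - int m) :: (nat \<Rightarrow> 'k::field_char_0 sphere_loc) set)"
proof
  fix w :: "nat \<Rightarrow> 'k sphere_loc"
  assume w: "w \<in> regular_tensors m c"
  then obtain p where p: "p \<in> forms m" "\<And>l. of_nat (m choose l) * w l = z_pow (- c) * p l"
    unfolding regular_tensors_def by blast
  have supp: "w \<in> supp m" using w by (simp add: regular_tensors_def)
  have "\<exists>b. w l = z_pow (- c - int m) * to_loc b" for l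
  proof (cases "l \<le> m")
    case True
    obtain a where a: "p l = z_inv ^ m * to_loc a" using forms_pole_order[OF p(1)] by blast
    let ?B = "of_nat (m choose l) :: 'k"
    have "?B \<noteq> 0" using True by (simp add: binomial_eq_0_iff)
    then have "w l = loc_const (inverse ?B * ?B) * w l" by simp
    also have "\<dots> = loc_const (inverse ?B) * (of_nat (m choose l) * w l)"
      by (simp only: loc_const_hom of_int_in_loc mult.assoc)
    also have "\<dots> = z_pow (- c) * z_pow (- int m) * to_loc (sphere_const (inverse ?B) * a)"
      unfolding p(2) a by (simp add: z_pow_nat loc_const_def mult_ac)
    also have "z_pow (- c) * z_pow (- int m) = (z_pow (- c - int m) :: 'k sphere_loc)"
      by (simp flip: z_pow_add)
    finally show ?thesis by blast
  next
    case False
    then have "w l = 0" using supp by (simp add: supp_def)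
    then show ?thesis by (intro exI[of _ 0]) simp
  qed
  with supp show "w \<in> z_filtration m (- c - int m)" by (simp add: z_filtration_def)
qed

section \<open>The generator and the submodule it generates\<close>

lemma w_gen_apply:
  "w_gen m \<alpha> l = (if l \<le> m then z_pow (int_of (- (\<alpha> + of_nat m) / 2)) *
    to_loc sphere_x ^ (m - l) * to_loc sphere_y ^ l else 0)"
proof -
  have "w_gen m \<alpha> l = (\<Sum>i\<le>m. if i = l then z_pow (int_of (- (\<alpha> + of_nat m) / 2)) *
    to_loc sphere_x ^ (m - i) * to_loc sphere_y ^ i else 0)"
    unfolding w_gen_def sum_apply by (intro sum.cong) (auto simp: tens_def v_basis_def)
  then show ?thesis by simp
qed

lemma sphere_x_power_not_0: "sphere_x ^ n \<noteq> (0 :: 'k::field sphere)"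
proof
  assume "sphere_x ^ n = (0 :: 'k sphere)"
  then have "sphere_of (poly_x ^ n) = sphere_of (0 :: 'k poly poly poly)"
    by (simp add: sphere_of_power sphere_x_def)
  then obtain r where "poly_x ^ n - (0 :: 'k poly poly poly) = sphere_poly * r"
    unfolding sphere_of_eq_iff by (elim dvdE)
  \<comment> \<open>Evaluation at the point (1, 0, 0) of the sphere.\<close>
  then have "poly (poly (poly (poly_x ^ n) 0) 0) (1 :: 'k) = poly (poly (poly (sphere_poly * r) 0) 0) 1"
    by simp
  then show False
    by (simp add: sphere_poly_def poly_x_def poly_y_def poly_z_def)
qed

lemma w_gen_not_0:
  fixes \<alpha> :: "'k::field"
  shows "w_gen m \<alpha> \<noteq> 0"
proof
  assume "w_gen m \<alpha> = 0"
  then have "z_pow (int_of (- (\<alpha> + of_nat m) / 2)) * to_loc (sphere_x ^ m) = (0 :: 'k sphere_loc)"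
    using w_gen_apply[of m \<alpha> 0] by simp
  then have "z_pow (- int_of (- (\<alpha> + of_nat m) / 2)) *
      z_pow (int_of (- (\<alpha> + of_nat m) / 2)) * to_loc (sphere_x ^ m) = (0 :: 'k sphere_loc)"
    by (simp only: mult.assoc mult_zero_right)
  then have "to_loc (sphere_x ^ m) = to_loc (0 :: 'k sphere)"
    by (simp only: z_pow_inverse mult_1_left to_loc_hom)
  then show False by (simp only: to_loc_eq_iff sphere_x_power_not_0)
qed

text \<open>The form is (-dz)^m from \<open>binomial_forms\<close>, since -(\<alpha> + m)/2 = -c -
  m.\<close>

lemma w_gen_regular:
  fixes \<alpha> :: "'k::field_char_0"
  assumes \<alpha>: "\<alpha> = of_nat m + 2 * of_int c"
  shows "w_gen m \<alpha> \<in> regular_tensors m c"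
proof -
  have e: "- (\<alpha> + of_nat m) / 2 = of_int (- c - int m)" by (simp add: \<alpha> field_simps)
  have "z_pow (- c - int m) = z_pow (- c) * (z_inv ^ m :: 'k sphere_loc)"
    by (simp flip: z_pow_add z_pow_nat(2))
  then have "of_nat (m choose l) * w_gen m \<alpha> l = z_pow (- c) *
      (of_nat (m choose l) * z_inv ^ m * to_loc sphere_x ^ (m - l) * to_loc sphere_y ^ l)" for l
    unfolding w_gen_apply e int_of_of_int by (simp add: binomial_eq_0 mult_ac)
  moreover have "w_gen m \<alpha> \<in> supp m" by (simp add: supp_def w_gen_apply)
  ultimately show ?thesis using binomial_forms[of m] by (intro regular_tensorsI)
qed

lemma AV_generated_submodule:
  assumes "w \<in> supp m"
  shows "AV_submodule m \<alpha> (AV_generated m \<alpha> w)"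
proof -
  \<comment> \<open>The whole space \<open>supp m\<close> is one of the submodules being
    intersected.\<close>
  have "AV_generated m \<alpha> w \<subseteq> supp m"
    using AV_submodule_supp assms unfolding AV_generated_def by blast
  then show ?thesis unfolding AV_submodule_def AV_generated_def by blast
qed

lemma AV_generated_w_gen_bounded:
  fixes \<alpha> :: "'k::field_char_0"
  assumes \<alpha>: "\<alpha> = of_nat m + 2 * of_int c"
  shows "bounded_AV_submodule m \<alpha> (AV_generated m \<alpha> (w_gen m \<alpha>))"
  unfolding bounded_AV_submodule_iff
proof (intro conjI exI)
  have "w_gen m \<alpha> \<in> AV_generated m \<alpha> (w_gen m \<alpha>)" by (simp add: AV_generated_def)
  then show "AV_generated m \<alpha> (w_gen m \<alpha>) \<noteq> {0}" using w_gen_not_0[of m \<alpha>] by blast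
  show "AV_submodule m \<alpha> (AV_generated m \<alpha> (w_gen m \<alpha>))"
    using w_gen_regular[OF \<alpha>] by (intro AV_generated_submodule) (simp add: regular_tensors_def)
  show "AV_generated m \<alpha> (w_gen m \<alpha>) \<subseteq> z_filtration m (- c - int m)"
    using regular_tensors_submodule[OF \<alpha>] w_gen_regular[OF \<alpha>] regular_tensors_filtration[of m c]
    unfolding AV_generated_def by blast
qed

theorem theorem14:
  fixes m :: nat and \<alpha> :: "'k::{alg_closed_field, field_char_0}"
  shows "((of_nat m - \<alpha>) / 2 \<in> \<int> \<longrightarrow> bounded_AV_submodule m \<alpha> (AV_generated m \<alpha> (w_gen m \<alpha>))) \<and>
    ((of_nat m - \<alpha>) / 2 \<notin> \<int> \<longrightarrow> \<not> (\<exists>M. bounded_AV_submodule m \<alpha> M))"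
proof (intro conjI impI)
  assume "(of_nat m - \<alpha>) / 2 \<in> \<int>"
  then obtain c where c: "(of_nat m - \<alpha>) / 2 = of_int c" by (elim Ints_cases)
  then have "of_nat m - \<alpha> = 2 * of_int c" by (simp add: field_simps)
  \<comment> \<open>The twist is (\<alpha> - m)/2, hence the change of sign.\<close>
  then have "\<alpha> = of_nat m + 2 * of_int (- c)" by (simp add: algebra_simps)
  then show "bounded_AV_submodule m \<alpha> (AV_generated m \<alpha> (w_gen m \<alpha>))"
    by (rule AV_generated_w_gen_bounded)
next
  assume "(of_nat m - \<alpha>) / 2 \<notin> \<int>"
  then show "\<not> (\<exists>M. bounded_AV_submodule m \<alpha> M)" by (simp add: no_bounded_AV_submodule)
qed

end
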